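(* Let $\mathbf{A}$ be a strongly Fregean algebra, $\mu\in\mathsf{Cm}(\mathbf{A})$, $U=\mu/\!\sim$ and $0_U=\bigwedge U$. Then: (1) $U=\{\beta\in\mathsf{Con}(\mathbf{A}): 0_U\le\beta\prec\mu^{+}\}$; (2) $U=\mathsf{Cm}(\mathbf{A})\cap I[0_U,\mu^{+})$; (3) if $\alpha\in\mathsf{Con}(\mathbf{A})$ and $0_U\le\alpha$, then either $\alpha\le\mu^{+}$ or $\mu^{+}\le\alpha$.
   Context: Conventions. $\mathsf{Con}(\mathbf{A})$ is the congruence lattice of an algebra $\mathbf{A}$. $\mathsf{Cm}(\mathbf{A})$ is the set of completely meet irreducible congruences; for $\eta\in\mathsf{Cm}(\mathbf{A})$, $\eta^{+}$ denotes the least congruence strictly greater than $\eta$. For $\alpha\le\beta$ in $\mathsf{Con}(\mathbf{A})$ let $I[\alpha,\beta]=\{\gamma:\alpha\le\gamma\le\beta\}$ and $I[\alpha,\beta)=\{\gamma:\alpha\le\gamma<\beta\}$; $\alpha\prec\beta$ means $\beta$ covers $\alpha$ in $\mathsf{Con}(\mathbf{A})$. Write $I[\alpha,\beta]\nearrow I[\gamma,\delta]$ (equivalently $I[\gamma,\delta]\searrow I[\alpha,\beta]$) if $\beta\wedge\gamma=\alpha$ and $\beta\vee\gamma=\delta$. Two intervals are projective if they are connected by a finite sequence of steps $\nearrow,\searrow$. When $\mathsf{Con}(\mathbf{A})$ is modular, for $\varphi,\psi\in\mathsf{Cm}(\mathbf{A})$ put $\varphi\sim\psi$ iff $I[\varphi,\varphi^{+}]$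 and $I[\psi,\psi^{+}]$ are projective; this is an equivalence relation. The language contains a distinguished constant term $1$. $\Theta_{\mathbf{A}}(c,d)$ is the least congruence containing $(c,d)$. $\mathbf{A}$ is congruence orderable if $\Theta_{\mathbf{A}}(1,a)=\Theta_{\mathbf{A}}(1,b)$ implies $a=b$ for $a,b\in A$; it is $1$-regular if $1/\alpha=1/\beta$ implies $\alpha=\beta$ for $\alpha,\beta\in\mathsf{Con}(\mathbf{A})$; it is Fregean if it is both. $\mathbf{A}$ is strongly Fregean if every homomorphic image of $\mathbf{A}$ is Fregean (with respect to $1$) and the variety generated by $\mathbf{A}$ is congruence modular. *)

theory Defs
  imports Main
begin

section \<open>Algebras, terms and homomorphisms\<close>

text \<open>A language is a type of operation symbols with a finite arity for each symbol; symbols of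
  arity 0 are constants. Operations are only constrained on argument lists of the right length.\<close>

record ('f, 'a) alg =
  carrier :: "'a set"
  oper :: "'f \<Rightarrow> 'a list \<Rightarrow> 'a"

datatype ('f, 'v) trm = Var 'v | Op 'f "('f, 'v) trm list"

definition algebra :: "('f \<Rightarrow> nat) \<Rightarrow> ('f, 'a) alg \<Rightarrow> bool" where
  "algebra ar A \<longleftrightarrow> carrier A \<noteq> {} \<and>
     (\<forall>f xs. length xs = ar f \<longrightarrow> set xs \<subseteq> carrier A \<longrightarrow> oper A f xs \<in> carrier A)"

fun wf_trm :: "('f \<Rightarrow> nat) \<Rightarrow> ('f, 'v) trm \<Rightarrow> bool" where
  "wf_trm ar (Var x) \<longleftrightarrow> True"
| "wf_trm ar (Op f ts) \<longleftrightarrow> length ts = ar f \<and> (\<forall>t\<in>set ts. wf_trm ar t)"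

fun eval :: "('f, 'a) alg \<Rightarrow> ('v \<Rightarrow> 'a) \<Rightarrow> ('f, 'v) trm \<Rightarrow> 'a" where
  "eval A v (Var x) = v x"
| "eval A v (Op f ts) = oper A f (map (eval A v) ts)"

definition satisfies :: "('f, 'a) alg \<Rightarrow> ('f, nat) trm \<Rightarrow> ('f, nat) trm \<Rightarrow> bool" where
  "satisfies A s t \<longleftrightarrow> (\<forall>v. range v \<subseteq> carrier A \<longrightarrow> eval A v s = eval A v t)"

definition epimorphism ::
    "('f \<Rightarrow> nat) \<Rightarrow> ('f, 'a) alg \<Rightarrow> ('f, 'b) alg \<Rightarrow> ('a \<Rightarrow> 'b) \<Rightarrow> bool" where
  "epimorphism ar A B h \<longleftrightarrow> h ` carrier A = carrier B \<and>
     (\<forall>f xs. length xs = ar f \<longrightarrow> set xs \<subseteq> carrier A \<longrightarrow>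
        h (oper A f xs) = oper B f (map h xs))"

definition homomorphic_image ::
    "('f \<Rightarrow> nat) \<Rightarrow> ('f, 'a) alg \<Rightarrow> ('f, 'b) alg \<Rightarrow> bool" where
  "homomorphic_image ar A B \<longleftrightarrow> algebra ar B \<and> (\<exists>h. epimorphism ar A B h)"

text \<open>A constant term may contain variables, as long as its value does not depend on them: in
  the language of a single binary operation \<open>\<leftrightarrow>\<close>, the constant 1 of equivalential algebras is
  the term \<open>x \<leftrightarrow> x\<close>. Terms without variables are a special case.\<close>

definition constant_term :: "('f \<Rightarrow> nat) \<Rightarrow> ('f, 'a) alg \<Rightarrow> ('f, nat) trm \<Rightarrow> bool" where
  "constant_term ar A e \<longleftrightarrow> wf_trm ar e \<and>
     (\<forall>v w. range v \<subseteq> carrier A \<longrightarrow> range w \<subseteq> carrier A \<longrightarrow> eval A v e = eval A w e)"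

definition const_val :: "('f, 'a) alg \<Rightarrow> ('f, nat) trm \<Rightarrow> 'a" where
  "const_val A e = (THE c. \<forall>v. range v \<subseteq> carrier A \<longrightarrow> eval A v e = c)"


section \<open>The congruence lattice\<close>

definition Con :: "('f \<Rightarrow> nat) \<Rightarrow> ('f, 'a) alg \<Rightarrow> ('a \<times> 'a) set set" where
  "Con ar A = {\<theta>. equiv (carrier A) \<theta> \<and>
     (\<forall>f xs ys. length xs = ar f \<longrightarrow> list_all2 (\<lambda>x y. (x, y) \<in> \<theta>) xs ys \<longrightarrow>
        (oper A f xs, oper A f ys) \<in> \<theta>)}"

text \<open>The meet of the empty family is the full congruence; the lattice order is inclusion, and
  binary meets are intersections.\<close>

definition con_Meet :: "('f, 'a) alg \<Rightarrow> ('a \<times> 'a) set set \<Rightarrow> ('a \<times> 'a) set" where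
  "con_Meet A F = carrier A \<times> carrier A \<inter> \<Inter> F"

definition Cg :: "('f \<Rightarrow> nat) \<Rightarrow> ('f, 'a) alg \<Rightarrow> ('a \<times> 'a) set \<Rightarrow> ('a \<times> 'a) set" where
  "Cg ar A R = con_Meet A {\<theta> \<in> Con ar A. R \<subseteq> \<theta>}"

definition con_join ::
    "('f \<Rightarrow> nat) \<Rightarrow> ('f, 'a) alg \<Rightarrow> ('a \<times> 'a) set \<Rightarrow> ('a \<times> 'a) set \<Rightarrow> ('a \<times> 'a) set" where
  "con_join ar A \<alpha> \<beta> = Cg ar A (\<alpha> \<union> \<beta>)"

definition congruence_modular :: "('f \<Rightarrow> nat) \<Rightarrow> ('f, 'a) alg \<Rightarrow> bool" where
  "congruence_modular ar A \<longleftrightarrow>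
     (\<forall>\<alpha>\<in>Con ar A. \<forall>\<beta>\<in>Con ar A. \<forall>\<gamma>\<in>Con ar A. \<alpha> \<subseteq> \<gamma> \<longrightarrow>
        con_join ar A \<alpha> (\<beta> \<inter> \<gamma>) = con_join ar A \<alpha> \<beta> \<inter> \<gamma>)"

text \<open>Completely meet irreducible; the case \<open>F = {}\<close> excludes the full congruence.\<close>

definition Cm :: "('f \<Rightarrow> nat) \<Rightarrow> ('f, 'a) alg \<Rightarrow> ('a \<times> 'a) set set" where
  "Cm ar A = {\<eta> \<in> Con ar A. \<forall>F \<subseteq> Con ar A. con_Meet A F = \<eta> \<longrightarrow> \<eta> \<in> F}"

definition upper_cover ::
    "('f \<Rightarrow> nat) \<Rightarrow> ('f, 'a) alg \<Rightarrow> ('a \<times> 'a) set \<Rightarrow> ('a \<times> 'a) set" where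
  "upper_cover ar A \<eta> =
     (THE \<gamma>. \<gamma> \<in> Con ar A \<and> \<eta> \<subset> \<gamma> \<and> (\<forall>\<delta>\<in>Con ar A. \<eta> \<subset> \<delta> \<longrightarrow> \<gamma> \<subseteq> \<delta>))"

definition covered_by ::
    "('f \<Rightarrow> nat) \<Rightarrow> ('f, 'a) alg \<Rightarrow> ('a \<times> 'a) set \<Rightarrow> ('a \<times> 'a) set \<Rightarrow> bool" where
  "covered_by ar A \<alpha> \<beta> \<longleftrightarrow> \<alpha> \<in> Con ar A \<and> \<beta> \<in> Con ar A \<and> \<alpha> \<subset> \<beta> \<and>
     (\<forall>\<gamma>\<in>Con ar A. \<not> (\<alpha> \<subset> \<gamma> \<and> \<gamma> \<subset> \<beta>))"

definition con_ivl_right_open ::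
    "('f \<Rightarrow> nat) \<Rightarrow> ('f, 'a) alg \<Rightarrow> ('a \<times> 'a) set \<Rightarrow> ('a \<times> 'a) set \<Rightarrow> ('a \<times> 'a) set set" where
  "con_ivl_right_open ar A \<alpha> \<beta> = {\<gamma> \<in> Con ar A. \<alpha> \<subseteq> \<gamma> \<and> \<gamma> \<subset> \<beta>}"

text \<open>An interval is represented by the pair of its endpoints, which it determines.\<close>

type_synonym 'a con_ivl = "('a \<times> 'a) set \<times> ('a \<times> 'a) set"

definition is_ivl :: "('f \<Rightarrow> nat) \<Rightarrow> ('f, 'a) alg \<Rightarrow> 'a con_ivl \<Rightarrow> bool" where
  "is_ivl ar A I \<longleftrightarrow> fst I \<in> Con ar A \<and> snd I \<in> Con ar A \<and> fst I \<subseteq> snd I"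

definition transposes_up :: "('f \<Rightarrow> nat) \<Rightarrow> ('f, 'a) alg \<Rightarrow> 'a con_ivl \<Rightarrow> 'a con_ivl \<Rightarrow> bool" where
  "transposes_up ar A I J \<longleftrightarrow> is_ivl ar A I \<and> is_ivl ar A J \<and>
     snd I \<inter> fst J = fst I \<and> con_join ar A (snd I) (fst J) = snd J"

definition projective :: "('f \<Rightarrow> nat) \<Rightarrow> ('f, 'a) alg \<Rightarrow> 'a con_ivl \<Rightarrow> 'a con_ivl \<Rightarrow> bool" where
  "projective ar A = (\<lambda>I J. transposes_up ar A I J \<or> transposes_up ar A J I)\<^sup>*\<^sup>*"

definition Cm_sim ::
    "('f \<Rightarrow> nat) \<Rightarrow> ('f, 'a) alg \<Rightarrow> ('a \<times> 'a) set \<Rightarrow> ('a \<times> 'a) set \<Rightarrow> bool" where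
  "Cm_sim ar A \<phi> \<psi> \<longleftrightarrow> \<phi> \<in> Cm ar A \<and> \<psi> \<in> Cm ar A \<and>
     projective ar A (\<phi>, upper_cover ar A \<phi>) (\<psi>, upper_cover ar A \<psi>)"

definition sim_class ::
    "('f \<Rightarrow> nat) \<Rightarrow> ('f, 'a) alg \<Rightarrow> ('a \<times> 'a) set \<Rightarrow> ('a \<times> 'a) set set" where
  "sim_class ar A \<mu> = {\<phi>. Cm_sim ar A \<mu> \<phi>}"


section \<open>Fregean algebras\<close>

definition congruence_orderable ::
    "('f \<Rightarrow> nat) \<Rightarrow> ('f, 'a) alg \<Rightarrow> ('f, nat) trm \<Rightarrow> bool" where
  "congruence_orderable ar A e \<longleftrightarrow>
     (\<forall>a\<in>carrier A. \<forall>b\<in>carrier A.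
        Cg ar A {(const_val A e, a)} = Cg ar A {(const_val A e, b)} \<longrightarrow> a = b)"

definition one_regular :: "('f \<Rightarrow> nat) \<Rightarrow> ('f, 'a) alg \<Rightarrow> ('f, nat) trm \<Rightarrow> bool" where
  "one_regular ar A e \<longleftrightarrow>
     (\<forall>\<alpha>\<in>Con ar A. \<forall>\<beta>\<in>Con ar A.
        \<alpha> `` {const_val A e} = \<beta> `` {const_val A e} \<longrightarrow> \<alpha> = \<beta>)"

definition Fregean :: "('f \<Rightarrow> nat) \<Rightarrow> ('f, 'a) alg \<Rightarrow> ('f, nat) trm \<Rightarrow> bool" where
  "Fregean ar A e \<longleftrightarrow> congruence_orderable ar A e \<and> one_regular ar A e"

text \<open>The variety generated by an algebra is the least equational class containing it, that is,
  the class of all models of its identities.\<close>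

definition in_variety :: "('f \<Rightarrow> nat) \<Rightarrow> ('f, 'a) alg \<Rightarrow> ('f, 'b) alg \<Rightarrow> bool" where
  "in_variety ar A B \<longleftrightarrow> algebra ar B \<and>
     (\<forall>s t. wf_trm ar s \<longrightarrow> wf_trm ar t \<longrightarrow> satisfies A s t \<longrightarrow> satisfies B s t)"

text \<open>The members of a variety have carriers in arbitrary types, over which a definition cannot
  quantify. The type \<open>(nat \<Rightarrow> 'a) \<Rightarrow> 'a\<close> suffices, since it contains the free algebra of the variety
  on countably many generators: by lemma \<open>variety_congruence_modularD\<close> below, modularity for the
  members with carrier in this type gives it for the members with carrier in any type.\<close>

definition variety_congruence_modular :: "('f \<Rightarrow> nat) \<Rightarrow> ('f, 'a) alg \<Rightarrow> bool" where
  "variety_congruence_modular ar A \<longleftrightarrow>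
     (\<forall>B :: ('f, (nat \<Rightarrow> 'a) \<Rightarrow> 'a) alg. in_variety ar A B \<longrightarrow> congruence_modular ar B)"

text \<open>Every homomorphic image of \<open>A\<close> is isomorphic to a quotient of \<open>A\<close>, whose elements are subsets
  of the carrier of \<open>A\<close>.\<close>

definition strongly_Fregean ::
    "('f \<Rightarrow> nat) \<Rightarrow> ('f, 'a) alg \<Rightarrow> ('f, nat) trm \<Rightarrow> bool" where
  "strongly_Fregean ar A e \<longleftrightarrow> algebra ar A \<and> constant_term ar A e \<and>
     (\<forall>B :: ('f, 'a set) alg. homomorphic_image ar A B \<longrightarrow> Fregean ar B e) \<and>
     variety_congruence_modular ar A"


section \<open>Modularity of the variety does not depend on the type of the carriers\<close>

lemma Con_equiv: "\<theta> \<in> Con ar A \<Longrightarrow> equiv (carrier A) \<theta>"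
  by (simp add: Con_def)

lemma Con_subset: "\<theta> \<in> Con ar A \<Longrightarrow> \<theta> \<subseteq> carrier A \<times> carrier A"
  by (auto dest!: Con_equiv simp: equiv_def refl_on_def)

lemma Con_compat:
  "\<theta> \<in> Con ar A \<Longrightarrow> length xs = ar f \<Longrightarrow> list_all2 (\<lambda>x y. (x, y) \<in> \<theta>) xs ys \<Longrightarrow>
    (oper A f xs, oper A f ys) \<in> \<theta>"
  by (simp add: Con_def)

lemma Con_Int:
  assumes "\<alpha> \<in> Con ar A" "\<beta> \<in> Con ar A" shows "\<alpha> \<inter> \<beta> \<in> Con ar A"
proof -
  have "equiv (carrier A) (\<alpha> \<inter> \<beta>)"
    using assms[THEN Con_equiv]
    by (auto simp: equiv_def refl_on_def sym_def intro: trans_Int)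
  moreover have "(oper A f xs, oper A f ys) \<in> \<alpha> \<inter> \<beta>"
    if l: "length xs = ar f" and a: "list_all2 (\<lambda>x y. (x, y) \<in> \<alpha> \<inter> \<beta>) xs ys" for f xs ys
    using assms[THEN Con_compat, OF l] a by (auto simp: list_all2_conv_all_nth)
  ultimately show ?thesis by (simp add: Con_def)
qed

lemma list_all2_sets:
  assumes "\<theta> \<subseteq> X \<times> Y" "list_all2 (\<lambda>x y. (x, y) \<in> \<theta>) xs ys"
  shows "set xs \<subseteq> X" "set ys \<subseteq> Y"
  using assms(2) assms(1) by (induction rule: list_all2_induct) auto

lemma full_Con:
  assumes "algebra ar A" shows "carrier A \<times> carrier A \<in> Con ar A"
proof -
  have "equiv (carrier A) (carrier A \<times> carrier A)"
    by (auto simp: equiv_def refl_on_def sym_def trans_def)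
  moreover have "(oper A f xs, oper A f ys) \<in> carrier A \<times> carrier A"
    if "length xs = ar f" "list_all2 (\<lambda>x y. (x, y) \<in> carrier A \<times> carrier A) xs ys" for f xs ys
    using assms that(1) list_all2_sets[OF subset_refl that(2)] list_all2_lengthD[OF that(2)]
    by (simp add: algebra_def)
  ultimately show ?thesis by (simp add: Con_def)
qed

lemma Cg_least: "\<theta> \<in> Con ar A \<Longrightarrow> R \<subseteq> \<theta> \<Longrightarrow> Cg ar A R \<subseteq> \<theta>"
  by (auto simp: Cg_def con_Meet_def)

lemma Cg_extensive: "R \<subseteq> carrier A \<times> carrier A \<Longrightarrow> R \<subseteq> Cg ar A R"
  by (auto simp: Cg_def con_Meet_def)

lemma Cg_trans: "trans (Cg ar A R)"
proof (rule transI)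
  fix x y z assume a: "(x, y) \<in> Cg ar A R" "(y, z) \<in> Cg ar A R"
  have "(x, z) \<in> \<theta>" if "\<theta> \<in> Con ar A" "R \<subseteq> \<theta>" for \<theta>
  proof -
    have "trans \<theta>" using Con_equiv[OF that(1)] by (simp add: equiv_def)
    then show ?thesis using Cg_least[OF that] a by (meson subsetD transE)
  qed
  then show "(x, z) \<in> Cg ar A R" using a by (auto simp: Cg_def con_Meet_def)
qed

lemma compat_coordinatewise:
  assumes tr: "trans \<theta>" and re: "refl_on (carrier A) \<theta>" and sub: "\<theta> \<subseteq> carrier A \<times> carrier A"
    and A: "algebra ar A"
    and one: "\<And>i xs y. length xs = ar f \<Longrightarrow> set xs \<subseteq> carrier A \<Longrightarrow> i < length xs \<Longrightarrow>
      (xs ! i, y) \<in> \<theta> \<Longrightarrow> (oper A f xs, oper A f (xs[i := y])) \<in> \<theta>"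
    and l: "length xs = ar f" and a: "list_all2 (\<lambda>x y. (x, y) \<in> \<theta>) xs ys"
  shows "(oper A f xs, oper A f ys) \<in> \<theta>"
proof -
  have len: "length ys = length xs" using a by (simp add: list_all2_lengthD)
  have xsA: "set xs \<subseteq> carrier A" and ysA: "set ys \<subseteq> carrier A"
    using list_all2_sets[OF sub a] by auto
  have "(oper A f xs, oper A f (take k ys @ drop k xs)) \<in> \<theta>" if "k \<le> length xs" for k
    using that
  proof (induction k)
    case 0
    then show ?case using A re xsA l by (auto simp: algebra_def refl_on_def)
  next
    case (Suc k)
    let ?z = "take k ys @ drop k xs"
    have k: "k < length xs" using Suc.prems by simp
    have zA: "set ?z \<subseteq> carrier A"
      using xsA ysA by (auto dest: in_set_takeD in_set_dropD)
    have zk: "?z ! k = xs ! k" using k len by (simp add: nth_append)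
    have "?z[k := ys ! k] = take (Suc k) ys @ drop (Suc k) xs"
      using k len
      by (simp add: list_update_append take_Suc_conv_app_nth Cons_nth_drop_Suc[symmetric])
    moreover have "(?z ! k, ys ! k) \<in> \<theta>"
      using a k zk by (simp add: list_all2_conv_all_nth)
    moreover have "length ?z = ar f" using k len l by simp
    ultimately have "(oper A f ?z, oper A f (take (Suc k) ys @ drop (Suc k) xs)) \<in> \<theta>"
      using one[of ?z k "ys ! k"] zA k l by simp
    then show ?case using Suc tr by (meson Suc_leD transE)
  qed
  from this[of "length xs"] show ?thesis using len by simp
qed

lemma con_join_subset_trancl:
  assumes A: "algebra ar A" and \<alpha>: "\<alpha> \<in> Con ar A" and \<beta>: "\<beta> \<in> Con ar A"
  shows "con_join ar A \<alpha> \<beta> \<subseteq> (\<alpha> \<union> \<beta>)\<^sup>+"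
proof -
  let ?T = "(\<alpha> \<union> \<beta>)\<^sup>+"
  have S: "\<alpha> \<union> \<beta> \<subseteq> carrier A \<times> carrier A" using Con_subset[OF \<alpha>] Con_subset[OF \<beta>] by blast
  then have sub: "?T \<subseteq> carrier A \<times> carrier A" by (rule trancl_subset_Sigma)
  have re: "refl_on (carrier A) ?T"
    using Con_equiv[OF \<alpha>] sub by (auto simp: equiv_def refl_on_def)
  have "sym (\<alpha> \<union> \<beta>)" using Con_equiv[OF \<alpha>] Con_equiv[OF \<beta>] by (simp add: equiv_def sym_Un)
  then have eq: "equiv (carrier A) ?T"
    using re sub by (auto simp: equiv_def intro: sym_trancl)
  have coord: "(oper A f (xs[i := y]), oper A f (xs[i := z])) \<in> \<alpha> \<union> \<beta>"
    if "length xs = ar f" "set xs \<subseteq> carrier A" "i < length xs" "(y, z) \<in> \<alpha> \<union> \<beta>" for f xs i y z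
  proof -
    have "list_all2 (\<lambda>x y. (x, y) \<in> \<theta>) (xs[i := y]) (xs[i := z])"
      if "\<theta> \<in> Con ar A" "(y, z) \<in> \<theta>" for \<theta>
    proof -
      have "(x, x) \<in> \<theta>" if "x \<in> carrier A" for x
        using that Con_equiv[OF \<open>\<theta> \<in> Con ar A\<close>] by (simp add: equiv_def refl_on_def)
      then have "(xs ! j, xs ! j) \<in> \<theta>" if "j < length xs" for j
        using that \<open>set xs \<subseteq> carrier A\<close> nth_mem by blast
      then show ?thesis using \<open>(y, z) \<in> \<theta>\<close> \<open>i < length xs\<close>
        by (simp add: list_all2_conv_all_nth nth_list_update)
    qed
    then show ?thesis using that \<alpha> \<beta> Con_compat[of _ ar A "xs[i := y]" f "xs[i := z]"] by auto
  qed
  have one: "(oper A f xs, oper A f (xs[i := y])) \<in> ?T"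
    if xs: "length xs = ar f" "set xs \<subseteq> carrier A" "i < length xs" and "(xs ! i, y) \<in> ?T"
    for f xs i y
    using that(4)
  proof (induction rule: trancl_induct)
    case (base y)
    then show ?case using coord[OF xs, of "xs ! i" y] by auto
  next
    case (step y z)
    have "(oper A f (xs[i := y]), oper A f (xs[i := z])) \<in> \<alpha> \<union> \<beta>"
      by (rule coord[OF xs step.hyps(2)])
    then show ?case using step.IH by (rule trancl_into_trancl[rotated])
  qed
  have "?T \<in> Con ar A"
    using eq compat_coordinatewise[OF trans_trancl re sub A one] by (simp add: Con_def)
  then show ?thesis unfolding con_join_def by (rule Cg_least) auto
qed

lemma con_pullback:
  assumes F: "algebra ar F" and cl: "h ` carrier F \<subseteq> carrier B"
    and hom: "\<And>f xs. length xs = ar f \<Longrightarrow> set xs \<subseteq> carrier F \<Longrightarrow>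
      h (oper F f xs) = oper B f (map h xs)"
    and \<theta>: "\<theta> \<in> Con ar B"
  shows "{(x, y) \<in> carrier F \<times> carrier F. (h x, h y) \<in> \<theta>} \<in> Con ar F" (is "?P \<in> _")
proof -
  have "equiv (carrier F) ?P"
  proof (rule equivI)
    show "refl_on (carrier F) ?P"
      using Con_equiv[OF \<theta>] cl by (auto simp: equiv_def refl_on_def)
    show "sym ?P" using Con_equiv[OF \<theta>] by (auto simp: equiv_def intro!: symI dest: symD)
    show "trans ?P"
      using Con_equiv[OF \<theta>] by (auto simp: equiv_def intro!: transI dest: transD)
    show "?P \<subseteq> carrier F \<times> carrier F" by auto
  qed
  moreover have "(oper F f xs, oper F f ys) \<in> ?P"
    if l: "length xs = ar f" and a: "list_all2 (\<lambda>x y. (x, y) \<in> ?P) xs ys" for f xs ys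
  proof -
    have l': "length ys = ar f" using l a by (simp add: list_all2_lengthD)
    have s: "set xs \<subseteq> carrier F" "set ys \<subseteq> carrier F"
      using list_all2_sets[OF _ a, of "carrier F" "carrier F"] by auto
    have "list_all2 (\<lambda>x y. (x, y) \<in> \<theta>) (map h xs) (map h ys)"
      using a by (auto simp: list_all2_conv_all_nth)
    then have "(oper B f (map h xs), oper B f (map h ys)) \<in> \<theta>"
      using Con_compat[OF \<theta>] l by simp
    then show ?thesis using hom l l' s F by (auto simp: algebra_def)
  qed
  ultimately show ?thesis by (simp add: Con_def)
qed

lemma eval_in_carrier:
  "algebra ar A \<Longrightarrow> range v \<subseteq> carrier A \<Longrightarrow> wf_trm ar t \<Longrightarrow> eval A v t \<in> carrier A"
proof (induction t)
  case (Op f ts)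
  then have "set (map (eval A v) ts) \<subseteq> carrier A" by auto
  with Op.prems show ?case by (simp add: algebra_def)
qed auto

text \<open>The free algebra on countably many generators: the term operations of \<open>A\<close>.\<close>

definition term_op :: "('f, 'a) alg \<Rightarrow> ('f, nat) trm \<Rightarrow> (nat \<Rightarrow> 'a) \<Rightarrow> 'a" where
  "term_op A t = (\<lambda>v. if range v \<subseteq> carrier A then eval A v t else undefined)"

definition free_alg :: "('f \<Rightarrow> nat) \<Rightarrow> ('f, 'a) alg \<Rightarrow> ('f, (nat \<Rightarrow> 'a) \<Rightarrow> 'a) alg" where
  "free_alg ar A = \<lparr>carrier = {term_op A t | t. wf_trm ar t},
     oper = (\<lambda>f gs v. if range v \<subseteq> carrier A then oper A f (map (\<lambda>g. g v) gs) else undefined)\<rparr>"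

lemma term_op_eq_iff: "term_op A s = term_op A t \<longleftrightarrow> satisfies A s t"
  by (auto simp: term_op_def satisfies_def fun_eq_iff)

lemma oper_free_alg: "oper (free_alg ar A) f (map (term_op A) ts) = term_op A (Op f ts)"
  by (auto simp: free_alg_def term_op_def fun_eq_iff intro!: arg_cong[where f = "oper A f"])

lemma free_alg_list:
  assumes "set gs \<subseteq> carrier (free_alg ar A)"
  obtains ts where "gs = map (term_op A) ts" "\<forall>t\<in>set ts. wf_trm ar t"
proof -
  have "gs \<in> lists (term_op A ` {t. wf_trm ar t})"
    using assms by (auto simp: free_alg_def)
  then have "gs \<in> map (term_op A) ` lists {t. wf_trm ar t}" by (simp add: lists_image)
  then show ?thesis using that by auto
qed

lemma algebra_free_alg: "algebra ar (free_alg ar A)"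
  unfolding algebra_def
proof (intro conjI allI impI)
  have "wf_trm ar (Var 0)" by simp
  then show "carrier (free_alg ar A) \<noteq> {}" unfolding free_alg_def by (simp del: wf_trm.simps) blast
next
  fix f gs assume l: "length gs = ar f" and "set gs \<subseteq> carrier (free_alg ar A)"
  then obtain ts where "gs = map (term_op A) ts" "\<forall>t\<in>set ts. wf_trm ar t"
    using free_alg_list by blast
  then show "oper (free_alg ar A) f gs \<in> carrier (free_alg ar A)"
    using l oper_free_alg[of ar A f ts] by (auto simp: free_alg_def intro!: exI[of _ "Op f ts"])
qed

lemma free_alg_in_variety:
  fixes A :: "('f, 'a) alg"
  assumes "algebra ar A" shows "in_variety ar A (free_alg ar A)"
  unfolding in_variety_def satisfies_def
proof (intro conjI allI impI algebra_free_alg)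
  fix s t :: "('f, nat) trm" and v :: "nat \<Rightarrow> (nat \<Rightarrow> 'a) \<Rightarrow> 'a"
  assume st: "\<forall>v. range v \<subseteq> carrier A \<longrightarrow> eval A v s = eval A v t"
    and v: "range v \<subseteq> carrier (free_alg ar A)"
  have cl: "v i w \<in> carrier A" if "range w \<subseteq> carrier A" for i w
  proof -
    obtain r where "v i = term_op A r" "wf_trm ar r" using v by (auto simp: free_alg_def)
    then show ?thesis using eval_in_carrier[OF assms that] that by (simp add: term_op_def)
  qed
  have good: "eval (free_alg ar A) v r w = eval A (\<lambda>i. v i w) r" if "range w \<subseteq> carrier A" for w r
    using that by (induction r) (auto simp: free_alg_def intro!: arg_cong[where f = "oper A _"])
  have bad: "eval (free_alg ar A) v r w = undefined" if "\<not> range w \<subseteq> carrier A" for w r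
  proof (cases r)
    case (Var i)
    obtain r' where "v i = term_op A r'" using v by (auto simp: free_alg_def)
    then show ?thesis using that Var by (simp add: term_op_def)
  qed (use that in \<open>auto simp: free_alg_def\<close>)
  show "eval (free_alg ar A) v s = eval (free_alg ar A) v t"
  proof
    fix w
    show "eval (free_alg ar A) v s w = eval (free_alg ar A) v t w"
    proof (cases "range w \<subseteq> carrier A")
      case True
      then have "range (\<lambda>i. v i w) \<subseteq> carrier A" using cl by auto
      then show ?thesis using good[OF True] st by simp
    qed (simp add: bad)
  qed
qed

lemma trancl_path:
  assumes "(a, b) \<in> R\<^sup>+"
  shows "\<exists>w (n :: nat). w 0 = a \<and> w n = b \<and> (\<forall>i<n. (w i, w (Suc i)) \<in> R) \<and> (\<forall>i>n. w i = b)"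
  using assms
proof (induction rule: converse_trancl_induct)
  case (base y)
  show ?case
    by (rule exI[of _ "case_nat y (\<lambda>_. b)"], rule exI[of _ 1])
       (use base in \<open>auto split: nat.splits\<close>)
next
  case (step y z)
  then obtain w n where w: "w 0 = z" "w n = b" "\<forall>i<n. (w i, w (Suc i)) \<in> R" "\<forall>i>n. w i = b"
    by blast
  show ?case
    by (rule exI[of _ "case_nat y w"], rule exI[of _ "Suc n"])
       (use step w in \<open>auto split: nat.splits simp: less_Suc_eq_0_disj\<close>)
qed

theorem variety_congruence_modularD:
  fixes A :: "('f, 'a) alg" and B :: "('f, 'b) alg"
  assumes A: "algebra ar A" and mod: "variety_congruence_modular ar A" and B: "in_variety ar A B"
  shows "congruence_modular ar B"
  unfolding congruence_modular_def
proof (intro ballI impI)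
  fix \<alpha> \<beta> \<gamma>
  assume \<alpha>: "\<alpha> \<in> Con ar B" and \<beta>: "\<beta> \<in> Con ar B" and \<gamma>: "\<gamma> \<in> Con ar B" and \<alpha>\<gamma>: "\<alpha> \<subseteq> \<gamma>"
  let ?F = "free_alg ar A"
  have algB: "algebra ar B" using B by (simp add: in_variety_def)
  have algF: "algebra ar ?F" by (rule algebra_free_alg)
  have modF: "congruence_modular ar ?F"
    using mod free_alg_in_variety[OF A] by (simp add: variety_congruence_modular_def)
  have full: "\<alpha> \<union> \<beta> \<subseteq> carrier B \<times> carrier B" "\<alpha> \<union> (\<beta> \<inter> \<gamma>) \<subseteq> carrier B \<times> carrier B"
    using Con_subset[OF \<alpha>] Con_subset[OF \<beta>] by auto
  show "con_join ar B \<alpha> (\<beta> \<inter> \<gamma>) = con_join ar B \<alpha> \<beta> \<inter> \<gamma>"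
  proof
    have "Cg ar B (\<alpha> \<union> (\<beta> \<inter> \<gamma>)) \<subseteq> Cg ar B (\<alpha> \<union> \<beta>)"
      unfolding Cg_def con_Meet_def by blast
    moreover have "Cg ar B (\<alpha> \<union> (\<beta> \<inter> \<gamma>)) \<subseteq> \<gamma>" using Cg_least[OF \<gamma>] \<alpha>\<gamma> by auto
    ultimately show "con_join ar B \<alpha> (\<beta> \<inter> \<gamma>) \<subseteq> con_join ar B \<alpha> \<beta> \<inter> \<gamma>"
      by (simp add: con_join_def)
  next
    show "con_join ar B \<alpha> \<beta> \<inter> \<gamma> \<subseteq> con_join ar B \<alpha> (\<beta> \<inter> \<gamma>)"
    proof (rule subrelI)
      fix a b assume "(a, b) \<in> con_join ar B \<alpha> \<beta> \<inter> \<gamma>"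
      then have ab: "(a, b) \<in> (\<alpha> \<union> \<beta>)\<^sup>+" and ab\<gamma>: "(a, b) \<in> \<gamma>"
        using con_join_subset_trancl[OF algB \<alpha> \<beta>] by auto
      obtain w n where w: "w 0 = a" "w n = b" "\<forall>i<n. (w i, w (Suc i)) \<in> \<alpha> \<union> \<beta>" "\<forall>i>n. w i = b"
        using trancl_path[OF ab] by blast
      have abB: "a \<in> carrier B" "b \<in> carrier B" using Con_subset[OF \<gamma>] ab\<gamma> by auto
      have wB: "range w \<subseteq> carrier B"
      proof (rule image_subsetI)
        fix i :: nat show "w i \<in> carrier B"
        proof (cases "i < n")
          case True
          then have "(w i, w (Suc i)) \<in> carrier B \<times> carrier B" using w(3) full(1) by (meson subsetD)
          then show ?thesis by simp
        next
          case False
          then have "w i = b" using w(2,4) by (cases "i = n") auto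
          then show ?thesis using abB by simp
        qed
      qed
      define h where "h g = eval B w (SOME t. wf_trm ar t \<and> term_op A t = g)" for g
      have h: "h (term_op A t) = eval B w t" if t: "wf_trm ar t" for t
      proof -
        let ?s = "SOME s. wf_trm ar s \<and> term_op A s = term_op A t"
        have "wf_trm ar ?s \<and> term_op A ?s = term_op A t"
          by (rule someI[of _ t]) (simp add: t)
        then have "satisfies B ?s t"
          using B t by (simp add: in_variety_def term_op_eq_iff)
        then show ?thesis using wB by (simp add: h_def satisfies_def)
      qed
      have cl: "h ` carrier ?F \<subseteq> carrier B"
        using h eval_in_carrier[OF algB wB] by (auto simp: free_alg_def)
      have hom: "h (oper ?F f gs) = oper B f (map h gs)"
        if l: "length gs = ar f" and "set gs \<subseteq> carrier ?F" for f gs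
      proof -
        obtain ts where ts: "gs = map (term_op A) ts" "\<forall>t\<in>set ts. wf_trm ar t"
          using free_alg_list \<open>set gs \<subseteq> carrier ?F\<close> by blast
        then have "h (oper ?F f gs) = eval B w (Op f ts)"
          using l h[of "Op f ts"] by (simp add: oper_free_alg)
        also have "\<dots> = oper B f (map h gs)"
          using ts h by (auto intro!: arg_cong[where f = "oper B f"])
        finally show ?thesis .
      qed
      define P where "P \<theta> = {(x, y) \<in> carrier ?F \<times> carrier ?F. (h x, h y) \<in> \<theta>}" for \<theta>
      have P: "P \<theta> \<in> Con ar ?F" if "\<theta> \<in> Con ar B" for \<theta>
        unfolding P_def by (rule con_pullback[OF algF cl hom that])
      define X :: "nat \<Rightarrow> (nat \<Rightarrow> 'a) \<Rightarrow> 'a" where "X i = term_op A (Var i)" for i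
      have X: "X i \<in> carrier ?F" for i
        unfolding X_def free_alg_def by (simp, rule exI[of _ "Var i"]) simp
      have hX: "h (X i) = w i" for i using h[of "Var i"] by (simp add: X_def)
      have PF: "P \<theta> \<subseteq> carrier ?F \<times> carrier ?F" for \<theta> by (auto simp: P_def)
      have ext: "P \<alpha> \<union> P \<beta> \<subseteq> con_join ar ?F (P \<alpha>) (P \<beta>)"
        unfolding con_join_def by (rule Cg_extensive) (use PF in blast)
      have "(X 0, X i) \<in> con_join ar ?F (P \<alpha>) (P \<beta>)" if "i \<le> n" for i
        using that
      proof (induction i)
        case 0
        have "(X 0, X 0) \<in> P \<alpha>"
          using Con_equiv[OF P[OF \<alpha>]] X by (simp add: equiv_def refl_on_def)
        then show ?case using ext by blast
      next
        case (Suc i)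
        have "(X i, X (Suc i)) \<in> P \<alpha> \<union> P \<beta>" using w(3) Suc.prems X by (auto simp: P_def hX)
        then show ?case using Suc ext Cg_trans[of ar ?F "P \<alpha> \<union> P \<beta>"]
          unfolding con_join_def by (meson Suc_leD subsetD transE)
      qed
      then have "(X 0, X n) \<in> con_join ar ?F (P \<alpha>) (P \<beta>) \<inter> P \<gamma>"
        using ab\<gamma> w X by (auto simp: P_def hX)
      moreover have "P \<alpha> \<subseteq> P \<gamma>" using \<alpha>\<gamma> by (auto simp: P_def)
      ultimately have XX: "(X 0, X n) \<in> con_join ar ?F (P \<alpha>) (P \<beta> \<inter> P \<gamma>)"
        using modF P[OF \<alpha>] P[OF \<beta>] P[OF \<gamma>] by (auto simp: congruence_modular_def)
      have "(a, b) \<in> \<theta>" if \<theta>: "\<theta> \<in> Con ar B" "\<alpha> \<union> (\<beta> \<inter> \<gamma>) \<subseteq> \<theta>" for \<theta>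
      proof -
        have "con_join ar ?F (P \<alpha>) (P \<beta> \<inter> P \<gamma>) \<subseteq> P \<theta>"
          unfolding con_join_def by (rule Cg_least[OF P[OF \<theta>(1)]]) (use \<theta>(2) in \<open>auto simp: P_def\<close>)
        then show ?thesis using XX w by (auto simp: P_def hX)
      qed
      then show "(a, b) \<in> con_join ar B \<alpha> (\<beta> \<inter> \<gamma>)"
        using abB by (auto simp: con_join_def Cg_def con_Meet_def)
    qed
  qed
qed

end

theory Submission
  imports Defs
begin

text \<open>Let \<open>1\<close> be the constant and write \<open>\<phi>\<^sup>+\<close> for the upper cover of \<open>\<phi>\<close>. Congruence
  orderability of the quotients makes the covers very small: if \<open>\<alpha> \<prec> \<beta>\<close>, then \<open>\<alpha>\<close> splits \<open>1/\<beta>\<close> into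
  just two classes (\<open>unit_class_splits_in_two\<close>), and if \<open>\<phi>\<close> is completely meet irreducible, then
  \<open>\<phi>\<close> and \<open>\<phi>\<^sup>+\<close> coincide outside \<open>1/\<phi>\<^sup>+\<close> (\<open>cover_trivial_off_unit_class\<close>). Together with
  1-regularity this reduces most questions to what happens on two-element sets.

  The invariant that controls projectivity is the set \<open>col \<alpha> \<beta>\<close> of unary polynomials that collapse
  \<open>1/\<beta>\<close> into one \<open>\<alpha>\<close>-class. If \<open>(\<alpha>, \<beta>)\<close> transposes up to \<open>(\<gamma>, \<delta>)\<close>, a witness \<open>b\<close> in
  \<open>1/\<beta>\<close> outside \<open>1/\<alpha>\<close> is also one for \<open>(\<gamma>, \<delta>)\<close>, and \<open>u(1)\<close>, \<open>u(b)\<close> are \<open>\<beta>\<close>-related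
  anyway, so they are \<open>\<alpha>\<close>-related iff they are \<open>\<gamma>\<close>-related; hence \<open>col\<close> is the same for
  projective covers. The centralizer of \<open>\<beta>\<close> modulo \<open>\<alpha>\<close> can be read off from \<open>col \<alpha> \<beta>\<close>: it is
  the congruence \<open>cen (col \<alpha> \<beta>)\<close> of all pairs \<open>(x, y)\<close> such that each binary polynomial \<open>p\<close> has
  both or none of \<open>p(x, _)\<close>, \<open>p(y, _)\<close> collapsing.

  The key step is \<open>cen_subset_cover\<close>: for \<open>\<phi>\<close> completely meet irreducible the centralizer lies
  below \<open>\<phi>\<^sup>+\<close>, so it is \<open>\<phi>\<close> or \<open>\<phi>\<^sup>+\<close>. This is where modularity of the whole variety enters,
  through Day terms. Since the centralizer and the property of being abelian are invariants of
  projectivity, distinct \<open>\<phi> \<sim> \<psi>\<close> must satisfy \<open>\<phi>\<^sup>+ = \<psi>\<^sup>+\<close>, and both covers are abelian with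
  centralizer \<open>\<phi>\<^sup>+\<close> (\<open>Cm_sim_invariants\<close>). Conversely, if \<open>\<phi>\<close> and \<open>\<psi>\<close> have the same cover and
  the same collapsing polynomials, then the pairs of the cover that lie in both or in none of them
  form a congruence, which is a common relative complement and makes them projective
  (\<open>Cm_sim_if_same_col\<close>).

  If \<open>U\<close> has just one element, then \<open>0\<^sub>U = \<mu>\<close> and everything is immediate. Otherwise the cover
  of \<open>\<mu>\<close> is abelian. Each non-collapsing polynomial \<open>u\<close> fixes or swaps the two classes of every
  member of \<open>U\<close> in \<open>1/\<mu>\<^sup>+\<close>, so \<open>u \<circ> u\<close> is the identity there modulo \<open>0\<^sub>U\<close>. Consequently, if
  \<open>\<alpha> \<ge> 0\<^sub>U\<close> and \<open>c\<close> is in \<open>1/\<mu>\<^sup>+\<close> outside \<open>1/\<alpha>\<close>, then \<open>u\<close> is in \<open>col \<mu> \<mu>\<^sup>+\<close> iff \<open>\<alpha>\<close>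
  identifies \<open>u(1)\<close> and \<open>u(c)\<close> (\<open>col_iff_above_zero_U\<close>). It follows that each \<open>\<alpha> \<ge> 0\<^sub>U\<close> that does
  not contain \<open>\<mu>\<^sup>+\<close> is contained in the centralizer of the cover of \<open>\<mu>\<close>, that is, in \<open>\<mu>\<^sup>+\<close>. For
  a completely meet irreducible \<open>\<psi>\<close> with \<open>0\<^sub>U \<le> \<psi> < \<mu>\<^sup>+\<close> it also follows that \<open>\<psi>\<close> and \<open>\<mu>\<close> have
  the same collapsing polynomials, hence \<open>\<mu>\<^sup>+ = \<psi>\<^sup>+\<close> and \<open>\<psi> \<sim> \<mu>\<close>. Finally, a congruence
  \<open>\<beta> \<ge> 0\<^sub>U\<close> covered by \<open>\<mu>\<^sup>+\<close> is completely meet irreducible, because all congruences above \<open>\<beta>\<close>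
  are comparable with \<open>\<mu>\<^sup>+\<close>.\<close>

section \<open>Congruences of an algebra\<close>

lemma Con_refl: "\<theta> \<in> Con ar A \<Longrightarrow> x \<in> carrier A \<Longrightarrow> (x, x) \<in> \<theta>"
  using Con_equiv[of \<theta> ar A] by (simp add: equiv_def refl_on_def)

lemma Con_sym: "\<theta> \<in> Con ar A \<Longrightarrow> (x, y) \<in> \<theta> \<Longrightarrow> (y, x) \<in> \<theta>"
  using Con_equiv[of \<theta> ar A] by (auto simp: equiv_def dest: symD)

lemma Con_trans: "\<theta> \<in> Con ar A \<Longrightarrow> (x, y) \<in> \<theta> \<Longrightarrow> (y, z) \<in> \<theta> \<Longrightarrow> (x, z) \<in> \<theta>"
  using Con_equiv[of \<theta> ar A] by (auto simp: equiv_def dest: transD)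

lemma con_Meet_Con:
  assumes A: "algebra ar A" and F: "F \<subseteq> Con ar A"
  shows "con_Meet A F \<in> Con ar A"
proof -
  have "equiv (carrier A) (con_Meet A F)"
  proof (rule equivI)
    show "refl_on (carrier A) (con_Meet A F)"
      using F by (auto simp: refl_on_def con_Meet_def intro: Con_refl)
    show "sym (con_Meet A F)"
      using F by (auto simp: sym_def con_Meet_def intro: Con_sym)
    show "trans (con_Meet A F)"
      using F by (auto simp: trans_def con_Meet_def intro: Con_trans)
    show "con_Meet A F \<subseteq> carrier A \<times> carrier A" by (auto simp: con_Meet_def)
  qed
  moreover have "(oper A f xs, oper A f ys) \<in> con_Meet A F"
    if l: "length xs = ar f" and a: "list_all2 (\<lambda>x y. (x, y) \<in> con_Meet A F) xs ys" for f xs ys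
  proof -
    have "(oper A f xs, oper A f ys) \<in> \<theta>"
      if "\<theta> \<in> insert (carrier A \<times> carrier A) F" for \<theta>
    proof (rule Con_compat[where ar = ar])
      show "\<theta> \<in> Con ar A" using that F full_Con[OF A] by auto
      show "list_all2 (\<lambda>x y. (x, y) \<in> \<theta>) xs ys"
        using a that by (auto simp: list_all2_conv_all_nth con_Meet_def)
    qed (rule l)
    then show ?thesis by (simp add: con_Meet_def del: mem_Sigma_iff)
  qed
  ultimately show ?thesis by (simp add: Con_def)
qed

lemma Cg_Con: "algebra ar A \<Longrightarrow> Cg ar A R \<in> Con ar A"
  unfolding Cg_def by (rule con_Meet_Con) auto

lemma con_join_Con: "algebra ar A \<Longrightarrow> con_join ar A \<alpha> \<beta> \<in> Con ar A"
  unfolding con_join_def by (rule Cg_Con)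

lemma con_join_upper:
  assumes "\<alpha> \<in> Con ar A" "\<beta> \<in> Con ar A"
  shows "\<alpha> \<subseteq> con_join ar A \<alpha> \<beta>" "\<beta> \<subseteq> con_join ar A \<alpha> \<beta>"
  using Cg_extensive[of "\<alpha> \<union> \<beta>" A ar] assms[THEN Con_subset] by (auto simp: con_join_def)

lemma con_join_least:
  "\<gamma> \<in> Con ar A \<Longrightarrow> \<alpha> \<subseteq> \<gamma> \<Longrightarrow> \<beta> \<subseteq> \<gamma> \<Longrightarrow> con_join ar A \<alpha> \<beta> \<subseteq> \<gamma>"
  unfolding con_join_def by (rule Cg_least) auto

lemma con_join_commute: "con_join ar A \<alpha> \<beta> = con_join ar A \<beta> \<alpha>"
  by (simp add: con_join_def Un_commute)

lemma con_modular_law: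
  assumes "congruence_modular ar A" "\<alpha> \<in> Con ar A" "\<beta> \<in> Con ar A" "\<gamma> \<in> Con ar A" "\<alpha> \<subseteq> \<gamma>"
  shows "con_join ar A \<alpha> (\<beta> \<inter> \<gamma>) = con_join ar A \<alpha> \<beta> \<inter> \<gamma>"
  using assms by (simp add: congruence_modular_def)

lemma covered_by_cases:
  assumes "covered_by ar A \<alpha> \<beta>" "\<gamma> \<in> Con ar A" "\<alpha> \<subseteq> \<gamma>" "\<gamma> \<subseteq> \<beta>"
  shows "\<gamma> = \<alpha> \<or> \<gamma> = \<beta>"
  using assms by (auto simp: covered_by_def)

lemma upper_cover_eqI:
  assumes "\<gamma> \<in> Con ar A" "\<eta> \<subset> \<gamma>" "\<forall>\<delta>\<in>Con ar A. \<eta> \<subset> \<delta> \<longrightarrow> \<gamma> \<subseteq> \<delta>"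
  shows "upper_cover ar A \<eta> = \<gamma>"
  unfolding upper_cover_def
proof (rule the_equality)
  show "\<gamma> \<in> Con ar A \<and> \<eta> \<subset> \<gamma> \<and> (\<forall>\<delta>\<in>Con ar A. \<eta> \<subset> \<delta> \<longrightarrow> \<gamma> \<subseteq> \<delta>)" using assms by simp
next
  fix \<beta> assume \<beta>: "\<beta> \<in> Con ar A \<and> \<eta> \<subset> \<beta> \<and> (\<forall>\<delta>\<in>Con ar A. \<eta> \<subset> \<delta> \<longrightarrow> \<beta> \<subseteq> \<delta>)"
  show "\<beta> = \<gamma>"
  proof (rule subset_antisym)
    show "\<beta> \<subseteq> \<gamma>" using \<beta> assms(1,2) by metis
    show "\<gamma> \<subseteq> \<beta>" using \<beta> assms(3) by metis
  qed
qed

lemma Cm_Con: "\<eta> \<in> Cm ar A \<Longrightarrow> \<eta> \<in> Con ar A"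
  unfolding Cm_def by blast

lemma CmD:
  assumes "\<eta> \<in> Cm ar A" "F \<subseteq> Con ar A" "con_Meet A F = \<eta>"
  shows "\<eta> \<in> F"
proof -
  have "\<forall>F \<subseteq> Con ar A. con_Meet A F = \<eta> \<longrightarrow> \<eta> \<in> F"
    using assms(1) unfolding Cm_def mem_Collect_eq by (rule conjunct2)
  from this[THEN spec, THEN mp, THEN mp, OF assms(2,3)] show ?thesis .
qed

lemma Cm_upper_cover:
  assumes A: "algebra ar A" and \<eta>: "\<eta> \<in> Cm ar A"
  shows upper_cover_Con: "upper_cover ar A \<eta> \<in> Con ar A"
    and upper_cover_greater: "\<eta> \<subset> upper_cover ar A \<eta>"
    and upper_cover_least: "\<delta> \<in> Con ar A \<Longrightarrow> \<eta> \<subset> \<delta> \<Longrightarrow> upper_cover ar A \<eta> \<subseteq> \<delta>"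
proof -
  let ?F = "{\<delta> \<in> Con ar A. \<eta> \<subset> \<delta>}"
  let ?M = "con_Meet A ?F"
  have M: "?M \<in> Con ar A" by (rule con_Meet_Con[OF A]) auto
  have "\<eta> \<subseteq> ?M" using Con_subset[OF Cm_Con[OF \<eta>]] by (auto simp: con_Meet_def)
  moreover have "\<eta> \<in> ?F" if "?M = \<eta>" by (rule CmD[OF \<eta> _ that]) auto
  ultimately have gt: "\<eta> \<subset> ?M" by auto
  have least: "\<forall>\<delta>\<in>Con ar A. \<eta> \<subset> \<delta> \<longrightarrow> ?M \<subseteq> \<delta>" by (auto simp: con_Meet_def)
  have eq: "upper_cover ar A \<eta> = ?M" by (rule upper_cover_eqI[OF M gt least])
  show "upper_cover ar A \<eta> \<in> Con ar A" "\<eta> \<subset> upper_cover ar A \<eta>" unfolding eq by (fact M gt)+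
  show "upper_cover ar A \<eta> \<subseteq> \<delta>" if "\<delta> \<in> Con ar A" "\<eta> \<subset> \<delta>" using least that unfolding eq by blast
qed

lemma covered_by_upper_cover:
  "algebra ar A \<Longrightarrow> \<eta> \<in> Cm ar A \<Longrightarrow> covered_by ar A \<eta> (upper_cover ar A \<eta>)"
  using Cm_upper_cover[of ar A \<eta>] by (auto simp: covered_by_def Cm_Con)

lemma CmI:
  assumes "\<eta> \<in> Con ar A" "\<gamma> \<in> Con ar A" "\<eta> \<subset> \<gamma>" "\<forall>\<delta>\<in>Con ar A. \<eta> \<subset> \<delta> \<longrightarrow> \<gamma> \<subseteq> \<delta>"
  shows "\<eta> \<in> Cm ar A"
  unfolding Cm_def
proof (intro CollectI conjI allI impI)
  fix F assume F: "F \<subseteq> Con ar A" and eq: "con_Meet A F = \<eta>"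
  show "\<eta> \<in> F"
  proof (rule ccontr)
    assume "\<eta> \<notin> F"
    then have "\<gamma> \<subseteq> \<delta>" if "\<delta> \<in> F" for \<delta>
      using that F eq assms(4) unfolding con_Meet_def by blast
    then have "\<gamma> \<subseteq> con_Meet A F" using Con_subset[OF assms(2)] by (auto simp: con_Meet_def)
    then show False using eq assms(3) by auto
  qed
qed (rule assms(1))


section \<open>Polynomial functions\<close>

text \<open>Unary polynomials are the case \<open>G = {\<lambda>x. x}\<close>, binary ones the case of the two projections
  from pairs. With \<open>G\<close> arbitrary, substitution is a single lemma for all arities.\<close>

inductive_set pol :: "('f \<Rightarrow> nat) \<Rightarrow> ('f, 'a) alg \<Rightarrow> ('x \<Rightarrow> 'a) set \<Rightarrow> ('x \<Rightarrow> 'a) set"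
  for ar :: "'f \<Rightarrow> nat" and A :: "('f, 'a) alg" and G :: "('x \<Rightarrow> 'a) set" where
  pol_gen: "g \<in> G \<Longrightarrow> g \<in> pol ar A G"
| pol_const: "c \<in> carrier A \<Longrightarrow> (\<lambda>_. c) \<in> pol ar A G"
| pol_oper: "length ps = ar f \<Longrightarrow> \<forall>p\<in>set ps. p \<in> pol ar A G \<Longrightarrow>
    (\<lambda>x. oper A f (map (\<lambda>p. p x) ps)) \<in> pol ar A G"

abbreviation pol1 :: "('f \<Rightarrow> nat) \<Rightarrow> ('f, 'a) alg \<Rightarrow> ('a \<Rightarrow> 'a) set" where
  "pol1 ar A \<equiv> pol ar A {\<lambda>x. x}"

abbreviation pol2 :: "('f \<Rightarrow> nat) \<Rightarrow> ('f, 'a) alg \<Rightarrow> ('a \<times> 'a \<Rightarrow> 'a) set" where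
  "pol2 ar A \<equiv> pol ar A {fst, snd}"

lemma pol_subst:
  assumes "p \<in> pol ar A G" "\<And>g. g \<in> G \<Longrightarrow> (\<lambda>y. g (h y)) \<in> pol ar A H"
  shows "(\<lambda>y. p (h y)) \<in> pol ar A H"
  using assms(1)
proof induction
  case (pol_oper ps f)
  then have "(\<lambda>y. oper A f (map (\<lambda>p. p y) (map (\<lambda>p y. p (h y)) ps))) \<in> pol ar A H"
    by (intro pol.pol_oper) auto
  then show ?case by (simp add: comp_def)
qed (use assms(2) in \<open>auto intro: pol.pol_const\<close>)

lemma pol_compat:
  assumes "\<theta> \<in> Con ar A" "\<And>g. g \<in> G \<Longrightarrow> (g x, g y) \<in> \<theta>" "p \<in> pol ar A G"
  shows "(p x, p y) \<in> \<theta>"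
  using assms(3)
proof induction
  case (pol_oper ps f)
  then show ?case
    using assms(1) by (intro Con_compat[where ar = ar]) (auto simp: list_all2_conv_all_nth)
qed (use assms in \<open>auto intro: Con_refl\<close>)

lemma pol1_compat:
  "\<theta> \<in> Con ar A \<Longrightarrow> (x, y) \<in> \<theta> \<Longrightarrow> u \<in> pol1 ar A \<Longrightarrow> (u x, u y) \<in> \<theta>"
  by (rule pol_compat) auto

lemma pol2_compat:
  "\<theta> \<in> Con ar A \<Longrightarrow> (x, x') \<in> \<theta> \<Longrightarrow> (y, y') \<in> \<theta> \<Longrightarrow> p \<in> pol2 ar A \<Longrightarrow> (p (x, y), p (x', y')) \<in> \<theta>"
  by (rule pol_compat) auto

lemma pol_eval:
  assumes "\<And>i. (\<lambda>x. w x i) \<in> pol ar A G" "wf_trm ar t"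
  shows "(\<lambda>x. eval A (w x) t) \<in> pol ar A G"
  using assms(2)
proof (induction t)
  case (Op f ts)
  then have "(\<lambda>x. oper A f (map (\<lambda>p. p x) (map (\<lambda>t x. eval A (w x) t) ts))) \<in> pol ar A G"
    by (intro pol_oper) auto
  then show ?case by (simp add: comp_def)
qed (use assms(1) in auto)

lemma pol1_translation:
  assumes "length xs = ar f" "set xs \<subseteq> carrier A" "i < length xs"
  shows "(\<lambda>z. oper A f (xs[i := z])) \<in> pol1 ar A"
proof -
  let ?ps = "(map (\<lambda>c _. c) xs)[i := \<lambda>x. x]"
  have "\<forall>p\<in>set ?ps. p \<in> pol1 ar A"
  proof
    fix p assume "p \<in> set ?ps"
    then have "p \<in> insert (\<lambda>x. x) (set (map (\<lambda>c _. c) xs))"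
      using set_update_subset_insert by fastforce
    then show "p \<in> pol1 ar A" using assms(2) by (auto intro: pol.intros)
  qed
  then have "(\<lambda>z. oper A f (map (\<lambda>p. p z) ?ps)) \<in> pol1 ar A"
    using assms(1) by (intro pol_oper) auto
  moreover have "map (\<lambda>p. p z) ?ps = xs[i := z]" for z by (simp add: map_update comp_def)
  ultimately show ?thesis by simp
qed

lemma Con_if_pol1_closed:
  assumes A: "algebra ar A" and eq: "equiv (carrier A) \<theta>"
    and cl: "\<And>u x y. u \<in> pol1 ar A \<Longrightarrow> (x, y) \<in> \<theta> \<Longrightarrow> (u x, u y) \<in> \<theta>"
  shows "\<theta> \<in> Con ar A"
proof -
  have "(oper A f xs, oper A f ys) \<in> \<theta>"
    if "length xs = ar f" "list_all2 (\<lambda>x y. (x, y) \<in> \<theta>) xs ys" for f xs ys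
  proof (rule compat_coordinatewise[OF _ _ _ A _ that])
    fix i zs y assume "length zs = ar f" "set zs \<subseteq> carrier A" "i < length zs" "(zs ! i, y) \<in> \<theta>"
    then show "(oper A f zs, oper A f (zs[i := y])) \<in> \<theta>"
      using cl[OF pol1_translation, of zs f i "zs ! i" y] by simp
  qed (use eq in \<open>auto simp: equiv_def\<close>)
  then show ?thesis using eq by (simp add: Con_def)
qed


section \<open>Day terms\<close>

text \<open>A set of valuations plays the role of a set of equations between the variables: the
  valuations satisfying the equations. The relation identifies two term operations if the equations
  force them to be equal in \<open>A\<close>.\<close>

definition agree :: "('f \<Rightarrow> nat) \<Rightarrow> ('f, 'a) alg \<Rightarrow> (nat \<Rightarrow> 'a) set \<Rightarrow>
    (((nat \<Rightarrow> 'a) \<Rightarrow> 'a) \<times> ((nat \<Rightarrow> 'a) \<Rightarrow> 'a)) set" where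
  "agree ar A V = {(g, h) \<in> carrier (free_alg ar A) \<times> carrier (free_alg ar A).
     \<forall>v\<in>V. range v \<subseteq> carrier A \<longrightarrow> g v = h v}"

lemma agree_Con: "agree ar A V \<in> Con ar (free_alg ar A)"
proof -
  let ?F = "free_alg ar A"
  have "equiv (carrier ?F) (agree ar A V)"
    by (rule equivI) (auto simp: agree_def refl_on_def sym_def trans_def)
  moreover have "(oper ?F f gs, oper ?F f hs) \<in> agree ar A V"
    if l: "length gs = ar f" and a: "list_all2 (\<lambda>g h. (g, h) \<in> agree ar A V) gs hs" for f gs hs
  proof -
    have s: "set gs \<subseteq> carrier ?F" "set hs \<subseteq> carrier ?F"
      using list_all2_sets[OF _ a, of "carrier ?F" "carrier ?F"] by (auto simp: agree_def)
    have l': "length hs = ar f" using l a by (simp add: list_all2_lengthD)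
    have "map (\<lambda>g. g v) gs = map (\<lambda>g. g v) hs" if "v \<in> V" "range v \<subseteq> carrier A" for v
      using a that by (auto simp: list_all2_conv_all_nth agree_def intro: nth_equalityI)
    then have "oper ?F f gs v = oper ?F f hs v" if "v \<in> V" "range v \<subseteq> carrier A" for v
      using that by (simp add: free_alg_def)
    then show ?thesis
      using s l l' algebra_free_alg[of ar A] by (simp add: agree_def algebra_def)
  qed
  ultimately show ?thesis by (simp add: Con_def)
qed

text \<open>Day's consequence of modularity, in the form of a test for membership in \<open>\<theta>\<close>. In the free
  algebra with generators \<open>X 0, \<dots>, X 3\<close>, let \<open>\<alpha>\<close>, \<open>\<beta>\<close>, \<open>\<gamma>\<close> express \<open>X 0 = X 3 \<and> X 1 = X 2\<close>,
  \<open>X 0 = X 1 \<and> X 2 = X 3\<close> and \<open>X 1 = X 2\<close>. Modularity puts \<open>(X 0, X 3)\<close> into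
  \<open>\<gamma> \<squnion> (\<beta> \<sqinter> \<alpha>)\<close>, and the members of a connecting chain are terms \<open>t\<close> with \<open>t(x,y,y,x) = x\<close>.
  The values \<open>t(x,x,x,y)\<close> along the chain start at \<open>x\<close> and end at \<open>y\<close>. A \<open>\<gamma>\<close>-step leaves them
  unchanged; a \<open>\<beta>\<close>-step leaves \<open>t(x,x,y,y)\<close> unchanged, which by hypothesis is the same modulo
  \<open>\<theta>\<close>.\<close>

lemma Day_criterion:
  fixes A :: "('f, 'a) alg"
  assumes A: "algebra ar A" and mod: "variety_congruence_modular ar A"
    and \<theta>: "\<theta> \<in> Con ar A" and xy: "x \<in> carrier A" "y \<in> carrier A"
    and terms: "\<And>t. wf_trm ar t \<Longrightarrow>
      (\<And>v :: nat \<Rightarrow> 'a. range v \<subseteq> carrier A \<Longrightarrow> v 0 = v 3 \<Longrightarrow> v 1 = v 2 \<Longrightarrow> eval A v t = v 0) \<Longrightarrow>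
      (eval A (\<lambda>i::nat. if i = 3 then y else x) t,
       eval A (\<lambda>i::nat. if i = 2 \<or> i = 3 then y else x) t) \<in> \<theta>"
  shows "(x, y) \<in> \<theta>"
proof -
  let ?F = "free_alg ar A"
  define \<alpha> where "\<alpha> = agree ar A {v. v 0 = v 3 \<and> v 1 = v 2}"
  define \<beta> where "\<beta> = agree ar A {v. v 0 = v 1 \<and> v 2 = v 3}"
  define \<gamma> where "\<gamma> = agree ar A {v. v 1 = v 2}"
  have con: "\<alpha> \<in> Con ar ?F" "\<beta> \<in> Con ar ?F" "\<gamma> \<in> Con ar ?F"
    by (simp_all add: \<alpha>_def \<beta>_def \<gamma>_def agree_Con)
  define X :: "nat \<Rightarrow> (nat \<Rightarrow> 'a) \<Rightarrow> 'a" where "X i = term_op A (Var i)" for i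
  have X: "X i \<in> carrier ?F" for i
    unfolding X_def free_alg_def by (simp, rule exI[of _ "Var i"]) simp
  have Xv: "X i v = v i" if "range v \<subseteq> carrier A" for i v using that by (simp add: X_def term_op_def)
  have \<gamma>\<alpha>: "\<gamma> \<subseteq> \<alpha>" by (auto simp: \<alpha>_def \<gamma>_def agree_def)
  have "(X 0, X 1) \<in> \<beta>" "(X 1, X 2) \<in> \<gamma>" "(X 2, X 3) \<in> \<beta>" and X03\<alpha>: "(X 0, X 3) \<in> \<alpha>"
    by (auto simp: \<alpha>_def \<beta>_def \<gamma>_def agree_def X Xv)
  moreover note con_join_upper[OF con(3,2)] con_join_Con[OF algebra_free_alg, of ar A \<gamma> \<beta>]
  ultimately have "(X 0, X 3) \<in> con_join ar ?F \<gamma> \<beta>"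
    by (meson Con_trans subsetD)
  then have "(X 0, X 3) \<in> con_join ar ?F \<gamma> (\<beta> \<inter> \<alpha>)"
    using X03\<alpha> con_modular_law[OF variety_congruence_modularD[OF A mod free_alg_in_variety[OF A]]
        con(3,2,1) \<gamma>\<alpha>] by simp
  then have path: "(X 0, X 3) \<in> (\<gamma> \<union> (\<beta> \<inter> \<alpha>))\<^sup>+"
    using con_join_subset_trancl[OF algebra_free_alg con(3) Con_Int[OF con(2,1)]] by blast
  let ?v = "\<lambda>i::nat. if i = 3 then y else x" and ?w = "\<lambda>i::nat. if i = 2 \<or> i = 3 then y else x"
  have vw: "range ?v \<subseteq> carrier A" "range ?w \<subseteq> carrier A" using xy by auto
  have terms': "(g ?v, g ?w) \<in> \<theta>" if "(X 0, g) \<in> \<alpha>" for g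
  proof -
    have "g \<in> carrier ?F" using that by (simp add: \<alpha>_def agree_def)
    then obtain t where t: "g = term_op A t" "wf_trm ar t"
      unfolding free_alg_def by auto
    have "eval A v t = v 0" if "range v \<subseteq> carrier A" "v 0 = v 3" "v 1 = v 2" for v
      using \<open>(X 0, g) \<in> \<alpha>\<close> that by (auto simp: \<alpha>_def agree_def Xv t term_op_def)
    from terms[OF t(2) this] show ?thesis using vw by (simp add: t term_op_def)
  qed
  have "(X 0, g) \<in> \<alpha> \<and> (x, g ?v) \<in> \<theta>" if "(X 0, g) \<in> (\<gamma> \<union> (\<beta> \<inter> \<alpha>))\<^sup>+" for g
  proof -
    have along: "(X 0, h) \<in> \<alpha> \<and> (x, h ?v) \<in> \<theta>"
      if g: "(X 0, g) \<in> \<alpha>" "(x, g ?v) \<in> \<theta>" and gh: "(g, h) \<in> \<gamma> \<union> (\<beta> \<inter> \<alpha>)" for g h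
    proof
      show h\<alpha>: "(X 0, h) \<in> \<alpha>" using g(1) gh \<gamma>\<alpha> Con_trans[OF con(1)] by blast
      have "(g ?v, h ?v) \<in> \<theta>"
      proof (cases "(g, h) \<in> \<gamma>")
        case True
        then have "g ?v = h ?v" using vw by (auto simp: \<gamma>_def agree_def)
        moreover have "g ?v \<in> carrier A" using terms'[OF g(1)] Con_subset[OF \<theta>] by blast
        ultimately show ?thesis using Con_refl[OF \<theta>, of "g ?v"] by simp
      next
        case False
        then have "g ?w = h ?w" using gh vw by (auto simp: \<beta>_def agree_def)
        then have "(g ?v, h ?w) \<in> \<theta>" using terms'[OF g(1)] by simp
        then show ?thesis by (rule Con_trans[OF \<theta> _ Con_sym[OF \<theta> terms'[OF h\<alpha>]]])
      qed
      then show "(x, h ?v) \<in> \<theta>" by (rule Con_trans[OF \<theta> g(2)])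
    qed
    have "(X 0, X 0) \<in> \<alpha>" using con(1) X by (rule Con_refl)
    moreover have "(x, X 0 ?v) \<in> \<theta>" using Con_refl[OF \<theta>] xy vw by (simp add: Xv)
    ultimately have start: "(X 0, X 0) \<in> \<alpha> \<and> (x, X 0 ?v) \<in> \<theta>" by simp
    from that show ?thesis
    proof (induction rule: trancl_induct)
      case (base h)
      then show ?case using along start by blast
    next
      case (step g h)
      then show ?case using along by blast
    qed
  qed
  from this[OF path] show ?thesis using vw by (simp add: Xv)
qed


section \<open>Quotients of a strongly Fregean algebra\<close>

lemma epimorphism_eval:
  assumes A: "algebra ar A" and h: "epimorphism ar A B h" and v: "range v \<subseteq> carrier A"
  shows "wf_trm ar t \<Longrightarrow> h (eval A v t) = eval B (\<lambda>i. h (v i)) t"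
proof (induction t)
  case (Op f ts)
  then have "set (map (eval A v) ts) \<subseteq> carrier A" using eval_in_carrier[OF A v] by auto
  then have "h (eval A v (Op f ts)) = oper B f (map h (map (eval A v) ts))"
    using h Op.prems by (simp add: epimorphism_def del: map_map)
  also have "map h (map (eval A v) ts) = map (eval B (\<lambda>i. h (v i))) ts"
    using Op by auto
  finally show ?case by simp
qed simp

lemma constant_term_wf: "constant_term ar A e \<Longrightarrow> wf_trm ar e"
  unfolding constant_term_def by (rule conjunct1)

lemma const_val_eval:
  assumes A: "algebra ar A" and e: "constant_term ar A e" and v: "range v \<subseteq> carrier A"
  shows "const_val A e = eval A v e"
  unfolding const_val_def
proof (rule the_equality)
  show "\<forall>w. range w \<subseteq> carrier A \<longrightarrow> eval A w e = eval A v e"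
    using e v unfolding constant_term_def by blast
qed (use v in blast)

lemma const_val_carrier:
  assumes A: "algebra ar A" and e: "constant_term ar A e"
  shows "const_val A e \<in> carrier A"
proof -
  obtain c where "c \<in> carrier A" using A by (auto simp: algebra_def)
  then have v: "range (\<lambda>_::nat. c) \<subseteq> carrier A" by auto
  show ?thesis
    using const_val_eval[OF A e v] eval_in_carrier[OF A v constant_term_wf[OF e]] by simp
qed

lemma const_val_epimorphism:
  assumes A: "algebra ar A" and e: "constant_term ar A e" and h: "epimorphism ar A B h"
  shows "const_val B e = h (const_val A e)"
  unfolding const_val_def[of B]
proof (rule the_equality)
  have im: "h ` carrier A = carrier B" using h by (simp add: epimorphism_def)
  show *: "\<forall>w. range w \<subseteq> carrier B \<longrightarrow> eval B w e = h (const_val A e)"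
  proof (intro allI impI)
    fix w :: "nat \<Rightarrow> 'c" assume w: "range w \<subseteq> carrier B"
    define v where "v i = inv_into (carrier A) h (w i)" for i
    have v: "v i \<in> carrier A" "h (v i) = w i" for i
      using w im unfolding v_def by (auto intro!: inv_into_into f_inv_into_f)
    then have "range v \<subseteq> carrier A" by auto
    then show "eval B w e = h (const_val A e)"
      using epimorphism_eval[OF A h _ constant_term_wf[OF e], of v] const_val_eval[OF A e, of v] v
      by simp
  qed
  fix c assume c: "\<forall>w. range w \<subseteq> carrier B \<longrightarrow> eval B w e = c"
  have "range (\<lambda>_::nat. h (const_val A e)) \<subseteq> carrier B" using const_val_carrier[OF A e] im by auto
  then show "c = h (const_val A e)" using * c by metis
qed

definition quotient_alg :: "('f, 'a) alg \<Rightarrow> ('a \<times> 'a) set \<Rightarrow> ('f, 'a set) alg" where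
  "quotient_alg A \<theta> = \<lparr>carrier = carrier A // \<theta>,
     oper = (\<lambda>f Xs. \<theta> `` {oper A f (map (\<lambda>X. SOME x. x \<in> X) Xs)})\<rparr>"

lemma quotient_alg_epimorphism:
  assumes A: "algebra ar A" and \<theta>: "\<theta> \<in> Con ar A"
  shows "epimorphism ar A (quotient_alg A \<theta>) (\<lambda>x. \<theta> `` {x})"
  unfolding epimorphism_def
proof (intro conjI allI impI)
  show "(\<lambda>x. \<theta> `` {x}) ` carrier A = carrier (quotient_alg A \<theta>)"
    by (auto simp: quotient_alg_def quotient_def)
next
  fix f xs assume l: "length xs = ar f" and xs: "set xs \<subseteq> carrier A"
  have "(x, SOME y. y \<in> \<theta> `` {x}) \<in> \<theta>" if "x \<in> carrier A" for x
    using someI[of "\<lambda>y. y \<in> \<theta> `` {x}" x] Con_refl[OF \<theta> that] by simp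
  then have "list_all2 (\<lambda>x y. (x, y) \<in> \<theta>) xs (map (\<lambda>x. SOME y. y \<in> \<theta> `` {x}) xs)"
    using xs nth_mem by (fastforce simp: list_all2_conv_all_nth)
  from equiv_class_eq[OF Con_equiv[OF \<theta>] Con_compat[OF \<theta> l this]]
  show "\<theta> `` {oper A f xs} = oper (quotient_alg A \<theta>) f (map (\<lambda>x. \<theta> `` {x}) xs)"
    by (simp add: quotient_alg_def comp_def)
qed

lemma epimorphism_algebra:
  assumes A: "algebra ar A" and h: "epimorphism ar A B h"
  shows "algebra ar B"
  unfolding algebra_def
proof (intro conjI allI impI)
  have im: "h ` carrier A = carrier B" using h by (simp add: epimorphism_def)
  show "carrier B \<noteq> {}" using A im by (auto simp: algebra_def)
  fix f ys assume l: "length ys = ar f" and ys: "set ys \<subseteq> carrier B"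
  then have "ys \<in> lists (h ` carrier A)" using im by auto
  then obtain xs where xs: "ys = map h xs" "set xs \<subseteq> carrier A" by (auto simp: lists_image)
  then have "oper B f ys = h (oper A f xs)" using h l by (simp add: epimorphism_def)
  then show "oper B f ys \<in> carrier B" using A l xs im by (auto simp: algebra_def)
qed

locale strongly_Fregean_algebra =
  fixes ar :: "'f \<Rightarrow> nat" and A :: "('f, 'a) alg" and e :: "('f, nat) trm"
  assumes strongly_Fregean: "strongly_Fregean ar A e"
begin

abbreviation unit :: 'a ("\<one>") where
  "\<one> \<equiv> const_val A e"

lemma algebra_A: "algebra ar A"
  using strongly_Fregean by (simp add: strongly_Fregean_def)

lemma constant_term_e: "constant_term ar A e"
  using strongly_Fregean by (simp add: strongly_Fregean_def)

lemma unit_carrier: "\<one> \<in> carrier A"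
  by (rule const_val_carrier[OF algebra_A constant_term_e])

lemma variety_modular: "variety_congruence_modular ar A"
  using strongly_Fregean by (simp add: strongly_Fregean_def)

lemma modular: "congruence_modular ar A"
  by (rule variety_congruence_modularD[OF algebra_A variety_modular])
     (simp add: in_variety_def algebra_A)

lemma Fregean_image:
  fixes B :: "('f, 'a set) alg"
  assumes "epimorphism ar A B h"
  shows "Fregean ar B e"
  using assms strongly_Fregean epimorphism_algebra[OF algebra_A assms]
  by (auto simp: strongly_Fregean_def homomorphic_image_def)

text \<open>Congruence orderability of the quotient by \<open>\<theta>\<close>, stated upstairs: an element is determined
  modulo \<open>\<theta>\<close> by the congruences above \<open>\<theta>\<close> that identify it with the constant.\<close>

lemma orderable_mod:
  assumes \<theta>: "\<theta> \<in> Con ar A" and ab: "a \<in> carrier A" "b \<in> carrier A"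
    and same: "\<And>\<gamma>. \<gamma> \<in> Con ar A \<Longrightarrow> \<theta> \<subseteq> \<gamma> \<Longrightarrow> (\<one>, a) \<in> \<gamma> \<longleftrightarrow> (\<one>, b) \<in> \<gamma>"
  shows "(a, b) \<in> \<theta>"
proof -
  let ?Q = "quotient_alg A \<theta>" and ?h = "\<lambda>x. \<theta> `` {x}"
  have h: "epimorphism ar A ?Q ?h" by (rule quotient_alg_epimorphism[OF algebra_A \<theta>])
  have hc: "?h x \<in> carrier ?Q" if "x \<in> carrier A" for x using h that by (auto simp: epimorphism_def)
  have unit: "const_val ?Q e = ?h \<one>"
    by (rule const_val_epimorphism[OF algebra_A constant_term_e h])
  have "(?h \<one>, ?h a) \<in> \<delta> \<longleftrightarrow> (?h \<one>, ?h b) \<in> \<delta>" if \<delta>: "\<delta> \<in> Con ar ?Q" for \<delta>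
  proof -
    let ?\<gamma> = "{(x, y) \<in> carrier A \<times> carrier A. (?h x, ?h y) \<in> \<delta>}"
    have "?\<gamma> \<in> Con ar A"
      by (rule con_pullback[OF algebra_A _ _ \<delta>]) (use h in \<open>auto simp: epimorphism_def\<close>)
    moreover have "\<theta> \<subseteq> ?\<gamma>"
    proof (rule subrelI)
      fix x y assume xy: "(x, y) \<in> \<theta>"
      then have xyA: "x \<in> carrier A" "y \<in> carrier A" using Con_subset[OF \<theta>] by auto
      have "?h x = ?h y" by (rule equiv_class_eq[OF Con_equiv[OF \<theta>] xy])
      then show "(x, y) \<in> ?\<gamma>" using xyA Con_refl[OF \<delta> hc[OF xyA(2)]] by simp
    qed
    ultimately show ?thesis using same[of ?\<gamma>] ab unit_carrier by simp
  qed
  then have "Cg ar ?Q {(const_val ?Q e, ?h a)} = Cg ar ?Q {(const_val ?Q e, ?h b)}"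
    unfolding Cg_def unit by (intro arg_cong[where f = "con_Meet ?Q"]) auto
  moreover have "congruence_orderable ar ?Q e"
    using Fregean_image[OF h] by (simp add: Fregean_def)
  ultimately have "?h a = ?h b"
    using hc[OF ab(1)] hc[OF ab(2)] by (simp add: congruence_orderable_def)
  then show ?thesis using eq_equiv_class[OF _ Con_equiv[OF \<theta>]] ab by blast
qed

text \<open>The definition of strongly Fregean speaks of homomorphic images whose elements are sets, so
  the 1-regularity of the algebra itself is read off from its copy on the singletons.\<close>

lemma regular:
  assumes \<alpha>: "\<alpha> \<in> Con ar A" and \<beta>: "\<beta> \<in> Con ar A"
    and same: "\<And>x. (\<one>, x) \<in> \<alpha> \<longleftrightarrow> (\<one>, x) \<in> \<beta>"
  shows "\<alpha> = \<beta>"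
proof -
  define B where "B = \<lparr>carrier = (\<lambda>x. {x}) ` carrier A,
    oper = (\<lambda>f Xs. {oper A f (map the_elem Xs)})\<rparr>"
  have h: "epimorphism ar A B (\<lambda>x. {x})" by (simp add: epimorphism_def B_def comp_def)
  have algB: "algebra ar B" by (rule epimorphism_algebra[OF algebra_A h])
  have unit: "const_val B e = {\<one>}"
    by (rule const_val_epimorphism[OF algebra_A constant_term_e h])
  define P where "P \<gamma> = {(X, Y) \<in> carrier B \<times> carrier B. (the_elem X, the_elem Y) \<in> \<gamma>}" for \<gamma>
  have P: "P \<gamma> \<in> Con ar B" if "\<gamma> \<in> Con ar A" for \<gamma>
    unfolding P_def by (rule con_pullback[OF algB _ _ that]) (auto simp: B_def)
  have mem: "({x}, {y}) \<in> P \<gamma> \<longleftrightarrow> (x, y) \<in> \<gamma>" if "\<gamma> \<in> Con ar A" for x y \<gamma>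
    using Con_subset[OF that] by (auto simp: P_def B_def)
  have "P \<alpha> `` {const_val B e} = P \<beta> `` {const_val B e}"
  proof (rule set_eqI)
    fix X
    show "X \<in> P \<alpha> `` {const_val B e} \<longleftrightarrow> X \<in> P \<beta> `` {const_val B e}"
    proof (cases "X \<in> carrier B")
      case True
      then obtain x where "X = {x}" by (auto simp: B_def)
      then show ?thesis using mem[OF \<alpha>] mem[OF \<beta>] same unit by simp
    qed (simp add: P_def)
  qed
  moreover have "one_regular ar B e" using Fregean_image[OF h] by (simp add: Fregean_def)
  ultimately have "P \<alpha> = P \<beta>" using P[OF \<alpha>] P[OF \<beta>] by (simp add: one_regular_def)
  then show ?thesis using mem[OF \<alpha>] mem[OF \<beta>] by auto
qed


section \<open>Covers in the congruence lattice\<close>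

abbreviation covers :: "('a \<times> 'a) set \<Rightarrow> ('a \<times> 'a) set \<Rightarrow> bool" (infix "\<prec>" 50) where
  "\<alpha> \<prec> \<beta> \<equiv> covered_by ar A \<alpha> \<beta>"

abbreviation cover :: "('a \<times> 'a) set \<Rightarrow> ('a \<times> 'a) set" where
  "cover \<phi> \<equiv> upper_cover ar A \<phi>"

lemmas cover_Con = upper_cover_Con[OF algebra_A]
lemmas cover_greater = upper_cover_greater[OF algebra_A]
lemmas cover_least = upper_cover_least[OF algebra_A]
lemmas covers_cover = covered_by_upper_cover[OF algebra_A]

lemma covers_Con: "\<alpha> \<prec> \<beta> \<Longrightarrow> \<alpha> \<in> Con ar A" "\<alpha> \<prec> \<beta> \<Longrightarrow> \<beta> \<in> Con ar A"
  by (simp_all add: covered_by_def)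

lemma regular_subset:
  assumes "\<alpha> \<in> Con ar A" "\<beta> \<in> Con ar A" "\<And>x. (\<one>, x) \<in> \<alpha> \<Longrightarrow> (\<one>, x) \<in> \<beta>"
  shows "\<alpha> \<subseteq> \<beta>"
  using regular[OF assms(1) Con_Int[OF assms(1,2)]] assms(3) by blast

lemma regular_witness:
  assumes "\<alpha> \<in> Con ar A" "\<beta> \<in> Con ar A" "\<not> \<alpha> \<subseteq> \<beta>"
  obtains x where "(\<one>, x) \<in> \<alpha>" "(\<one>, x) \<notin> \<beta>"
  using regular_subset assms by blast

lemma covers_witness:
  assumes "\<alpha> \<prec> \<beta>"
  obtains b where "(\<one>, b) \<in> \<beta>" "(\<one>, b) \<notin> \<alpha>"
  using regular_witness[of \<beta> \<alpha>] assms by (auto simp: covered_by_def)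

text \<open>A congruence above \<open>\<alpha>\<close> that identifies the constant with some element of \<open>1/\<beta>\<close> outside
  \<open>1/\<alpha>\<close> contains \<open>\<beta>\<close>, so no congruence above \<open>\<alpha>\<close> tells two such elements apart.\<close>

lemma unit_class_splits_in_two:
  assumes cov: "\<alpha> \<prec> \<beta>" and b: "(\<one>, b) \<in> \<beta>" "(\<one>, b) \<notin> \<alpha>" and d: "(\<one>, d) \<in> \<beta>" "(\<one>, d) \<notin> \<alpha>"
  shows "(b, d) \<in> \<alpha>"
proof (rule orderable_mod)
  note con = covers_Con[OF cov]
  show "\<alpha> \<in> Con ar A" by (fact con)
  show "b \<in> carrier A" "d \<in> carrier A" using Con_subset[OF con(2)] b d by auto
  fix \<gamma> assume \<gamma>: "\<gamma> \<in> Con ar A" "\<alpha> \<subseteq> \<gamma>"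
  have "\<beta> \<subseteq> \<gamma>" if "(\<one>, x) \<in> \<gamma>" "(\<one>, x) \<in> \<beta>" "(\<one>, x) \<notin> \<alpha>" for x
  proof -
    have "\<alpha> \<subseteq> \<gamma> \<inter> \<beta>" using \<gamma>(2) cov by (auto simp: covered_by_def)
    then have "\<gamma> \<inter> \<beta> = \<alpha> \<or> \<gamma> \<inter> \<beta> = \<beta>"
      by (intro covered_by_cases[OF cov Con_Int[OF \<gamma>(1) con(2)]]) auto
    then show ?thesis using that by blast
  qed
  then show "(\<one>, b) \<in> \<gamma> \<longleftrightarrow> (\<one>, d) \<in> \<gamma>" using b d by blast
qed

lemma same_class_iff:
  assumes cov: "\<alpha> \<prec> \<beta>" and xy: "(\<one>, x) \<in> \<beta>" "(\<one>, y) \<in> \<beta>"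
  shows "(x, y) \<in> \<alpha> \<longleftrightarrow> ((\<one>, x) \<in> \<alpha> \<longleftrightarrow> (\<one>, y) \<in> \<alpha>)"
  using unit_class_splits_in_two[OF cov xy(1) _ xy(2)] covers_Con(1)[OF cov]
  by (meson Con_sym Con_trans)

text \<open>A congruence above \<open>\<phi>\<close> that identifies the constant with an element outside \<open>1/\<phi>\<^sup>+\<close> is
  different from \<open>\<phi>\<close> and therefore contains \<open>\<phi>\<^sup>+\<close>; orderability modulo \<open>\<phi>\<close> applies again.\<close>

lemma cover_trivial_off_unit_class:
  assumes \<phi>: "\<phi> \<in> Cm ar A" and ac: "(a, c) \<in> cover \<phi>" and a: "(\<one>, a) \<notin> cover \<phi>"
  shows "(a, c) \<in> \<phi>"
proof (rule orderable_mod)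
  note con = Cm_Con[OF \<phi>] cover_Con[OF \<phi>]
  show "\<phi> \<in> Con ar A" by (fact con)
  show "a \<in> carrier A" "c \<in> carrier A" using Con_subset[OF con(2)] ac by auto
  have ca: "(c, a) \<in> cover \<phi>" by (rule Con_sym[OF con(2) ac])
  have c: "(\<one>, c) \<notin> cover \<phi>" using Con_trans[OF con(2) _ ca] a by blast
  fix \<gamma> assume \<gamma>: "\<gamma> \<in> Con ar A" "\<phi> \<subseteq> \<gamma>"
  have "cover \<phi> \<subseteq> \<gamma>" if "(\<one>, x) \<in> \<gamma>" "(\<one>, x) \<notin> cover \<phi>" for x
    by (rule cover_least[OF \<phi> \<gamma>(1)]) (use \<gamma>(2) that cover_greater[OF \<phi>] in auto)
  then show "(\<one>, a) \<in> \<gamma> \<longleftrightarrow> (\<one>, c) \<in> \<gamma>"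
    using a c ac ca Con_trans[OF \<gamma>(1)] by blast
qed


section \<open>Collapsing polynomials and the centralizer\<close>

definition col :: "('a \<times> 'a) set \<Rightarrow> ('a \<times> 'a) set \<Rightarrow> ('a \<Rightarrow> 'a) set" where
  "col \<alpha> \<beta> = {u \<in> pol1 ar A. \<forall>b. (\<one>, b) \<in> \<beta> \<longrightarrow> (u \<one>, u b) \<in> \<alpha>}"

text \<open>For \<open>E = col \<alpha> \<beta>\<close> this is the term condition for the centralizer of \<open>\<beta>\<close> modulo \<open>\<alpha>\<close>.
  Having it as a function of \<open>E\<close> alone makes it an invariant of projectivity as soon as
  \<open>col\<close> is one.\<close>

definition cen :: "('a \<Rightarrow> 'a) set \<Rightarrow> ('a \<times> 'a) set" where
  "cen E = {(x, y) \<in> carrier A \<times> carrier A.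
     \<forall>p\<in>pol2 ar A. (\<lambda>z. p (x, z)) \<in> E \<longleftrightarrow> (\<lambda>z. p (y, z)) \<in> E}"

lemma col_pol1: "u \<in> col \<alpha> \<beta> \<Longrightarrow> u \<in> pol1 ar A"
  by (simp add: col_def)

text \<open>As \<open>1/\<beta>\<close> consists of two \<open>\<alpha>\<close>-classes, any pair of representatives decides whether a
  polynomial collapses.\<close>

lemma col_iff_pair:
  assumes cov: "\<alpha> \<prec> \<beta>" and u: "u \<in> pol1 ar A"
    and xy: "(\<one>, x) \<in> \<beta>" "(\<one>, y) \<in> \<beta>" "(x, y) \<notin> \<alpha>"
  shows "u \<in> col \<alpha> \<beta> \<longleftrightarrow> (u x, u y) \<in> \<alpha>"
proof
  note con = covers_Con(1)[OF cov]
  note tr = Con_trans[OF con] and sy = Con_sym[OF con] and cp = pol1_compat[OF con _ u]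
  show "(u x, u y) \<in> \<alpha>" if "u \<in> col \<alpha> \<beta>"
    using that xy tr sy unfolding col_def by blast
  assume uxy: "(u x, u y) \<in> \<alpha>"
  have "(u \<one>, u b) \<in> \<alpha>" if b: "(\<one>, b) \<in> \<beta>" for b
  proof (cases "(\<one>, b) \<in> \<alpha>")
    case True
    then show ?thesis by (rule cp)
  next
    case False
    consider "(\<one>, x) \<in> \<alpha>" "(b, y) \<in> \<alpha>" | "(\<one>, y) \<in> \<alpha>" "(b, x) \<in> \<alpha>"
      using same_class_iff[OF cov] xy b False by blast
    then show ?thesis
    proof cases
      case 1
      then show ?thesis using cp[OF 1(1)] cp[OF 1(2)] uxy tr sy by blast
    next
      case 2
      then show ?thesis using cp[OF 2(1)] cp[OF 2(2)] uxy tr sy by blast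
    qed
  qed
  then show "u \<in> col \<alpha> \<beta>" using u by (simp add: col_def)
qed

lemma col_iff:
  assumes cov: "\<alpha> \<prec> \<beta>" and u: "u \<in> pol1 ar A" and b: "(\<one>, b) \<in> \<beta>" "(\<one>, b) \<notin> \<alpha>"
  shows "u \<in> col \<alpha> \<beta> \<longleftrightarrow> (u \<one>, u b) \<in> \<alpha>"
  by (rule col_iff_pair[OF cov u _ b]) (rule Con_refl[OF covers_Con(2)[OF cov] unit_carrier])

lemma pol2_section: "p \<in> pol2 ar A \<Longrightarrow> x \<in> carrier A \<Longrightarrow> (\<lambda>z. p (x, z)) \<in> pol1 ar A"
  by (rule pol_subst[where h = "\<lambda>z. (x, z)"]) (auto intro: pol.intros)

lemma cen_Con: "cen E \<in> Con ar A"
proof (rule Con_if_pol1_closed[OF algebra_A])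
  show "equiv (carrier A) (cen E)"
    by (rule equivI) (auto simp: cen_def refl_on_def sym_def trans_def)
next
  fix u x y assume u: "u \<in> pol1 ar A" and xy: "(x, y) \<in> cen E"
  have u': "u z \<in> carrier A" if "z \<in> carrier A" for z
    using pol1_compat[OF full_Con[OF algebra_A] _ u, of z z] that by simp
  have "(\<lambda>z. p (u x, z)) \<in> E \<longleftrightarrow> (\<lambda>z. p (u y, z)) \<in> E" if p: "p \<in> pol2 ar A" for p
  proof -
    have fst: "(\<lambda>s. u (fst s)) \<in> pol2 ar A" by (rule pol_subst[OF u]) (auto intro: pol_gen)
    have "(\<lambda>s. p (u (fst s), snd s)) \<in> pol2 ar A"
      by (rule pol_subst[OF p]) (use fst in \<open>auto intro: pol_gen\<close>)
    then show ?thesis using xy unfolding cen_def by fastforce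
  qed
  then show "(u x, u y) \<in> cen E" using xy u' by (auto simp: cen_def)
qed

text \<open>If collapsing can be tested by \<open>\<alpha>\<close> at a single point \<open>c\<close>, then \<open>\<alpha>\<close>-related parameters of a
  binary polynomial give the same outcome. This serves for the lower end of a cover as well as for
  arbitrary congruences above the meet of a class.\<close>

lemma subset_cen:
  assumes \<alpha>: "\<alpha> \<in> Con ar A" and c: "c \<in> carrier A"
    and E: "\<And>u. u \<in> pol1 ar A \<Longrightarrow> u \<in> E \<longleftrightarrow> (u \<one>, u c) \<in> \<alpha>"
  shows "\<alpha> \<subseteq> cen E"
proof (rule subrelI)
  fix x y assume xy: "(x, y) \<in> \<alpha>"
  then have xyA: "x \<in> carrier A" "y \<in> carrier A" using Con_subset[OF \<alpha>] by auto
  have "(\<lambda>z. p (x, z)) \<in> E \<longleftrightarrow> (\<lambda>z. p (y, z)) \<in> E" if p: "p \<in> pol2 ar A" for p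
  proof -
    have "(p (x, z), p (y, z)) \<in> \<alpha>" if "z \<in> carrier A" for z
      by (rule pol2_compat[OF \<alpha> xy Con_refl[OF \<alpha> that] p])
    then show ?thesis
      using E[OF pol2_section[OF p xyA(1)]] E[OF pol2_section[OF p xyA(2)]] c unit_carrier
      by (meson Con_sym Con_trans \<alpha>)
  qed
  then show "(x, y) \<in> cen E" using xyA by (simp add: cen_def)
qed

lemma covers_subset_cen:
  assumes cov: "\<alpha> \<prec> \<beta>"
  shows "\<alpha> \<subseteq> cen (col \<alpha> \<beta>)"
proof -
  obtain b where b: "(\<one>, b) \<in> \<beta>" "(\<one>, b) \<notin> \<alpha>" by (rule covers_witness[OF cov])
  show ?thesis
    by (rule subset_cen[of _ b])
       (use b cov Con_subset[OF covers_Con(2)[OF cov]] in \<open>auto simp: covers_Con col_iff\<close>)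
qed

text \<open>Otherwise some pair \<open>(1,a)\<close> with \<open>a\<close> outside \<open>1/\<phi>\<^sup>+\<close> is in the centralizer, which is then
  strictly above \<open>\<phi>\<close> and so contains \<open>\<phi>\<^sup>+\<close>: the cover is abelian. For a Day term \<open>m\<close> the polynomial \<open>m(x,1,z,x)\<close> maps \<open>(a,1)\<close> to \<open>a\<close>, and
  the \<open>\<phi>\<^sup>+\<close>-class of \<open>a\<close> is a single \<open>\<phi>\<close>-class. So the polynomial is collapsing in \<open>z\<close> for
  \<open>x = a\<close>, and by centrality for \<open>x = 1\<close>. Moving only the last argument from \<open>1\<close> to \<open>b\<close>, which is
  allowed because the cover is abelian, shows \<open>m(1,1,1,b)\<close> and \<open>m(1,1,b,b)\<close> equal modulo \<open>\<phi>\<close>, so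
  that Day's test puts \<open>(1,b)\<close> into \<open>\<phi>\<close>; but \<open>b\<close> was chosen in \<open>1/\<phi>\<^sup>+\<close> outside \<open>1/\<phi>\<close>.\<close>

lemma cen_subset_cover:
  assumes \<phi>: "\<phi> \<in> Cm ar A"
  shows "cen (col \<phi> (cover \<phi>)) \<subseteq> cover \<phi>"
proof (rule ccontr)
  let ?E = "col \<phi> (cover \<phi>)"
  let ?Z = "cen ?E"
  note con = Cm_Con[OF \<phi>] cover_Con[OF \<phi>] and cov = covers_cover[OF \<phi>]
  assume "\<not> ?Z \<subseteq> cover \<phi>"
  then obtain a where a: "(\<one>, a) \<in> ?Z" "(\<one>, a) \<notin> cover \<phi>"
    by (rule regular_witness[OF cen_Con con(2)])
  have "\<phi> \<subset> ?Z" using covers_subset_cen[OF cov] a cover_greater[OF \<phi>] by auto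
  then have below: "cover \<phi> \<subseteq> ?Z" by (rule cover_least[OF \<phi> cen_Con])
  obtain b where b: "(\<one>, b) \<in> cover \<phi>" "(\<one>, b) \<notin> \<phi>" by (rule covers_witness[OF cov])
  have abA: "a \<in> carrier A" "b \<in> carrier A"
    using Con_subset[OF con(2)] Con_subset[OF cen_Con] a(1) b(1) by auto
  have "(\<one>, b) \<in> \<phi>"
  proof (rule Day_criterion[OF algebra_A variety_modular con(1) unit_carrier abA(2)])
    fix t :: "('f, nat) trm"
    assume t: "wf_trm ar t" and id: "\<And>v :: nat \<Rightarrow> 'a. range v \<subseteq> carrier A \<Longrightarrow> v 0 = v 3 \<Longrightarrow> v 1 = v 2 \<Longrightarrow>
      eval A v t = v 0"
    define m where "m x y z w = eval A (\<lambda>i::nat. if i = 0 then x else if i = 1 then y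
      else if i = 2 then z else if i = 3 then w else \<one>) t" for x y z w
    have m: "m x y y x = x" if "x \<in> carrier A" "y \<in> carrier A" for x y
      unfolding m_def by (subst id) (use that unit_carrier in auto)
    have m_pol2: "(\<lambda>s. m (f s) (g s) (h s) (k s)) \<in> pol2 ar A"
      if "f \<in> pol2 ar A" "g \<in> pol2 ar A" "h \<in> pol2 ar A" "k \<in> pol2 ar A" for f g h k
      unfolding m_def
    proof (rule pol_eval[OF _ t])
      fix i :: nat
      show "(\<lambda>s. if i = 0 then f s else if i = 1 then g s else if i = 2 then h s
          else if i = 3 then k s else \<one>) \<in> pol2 ar A"
        using that unit_carrier
        by (cases "i = 0"; cases "i = 1"; cases "i = 2"; cases "i = 3") (auto intro: pol_const)
    qed
    have gens: "fst \<in> pol2 ar A" "snd \<in> pol2 ar A" "(\<lambda>_. \<one>) \<in> pol2 ar A"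
      using unit_carrier by (auto intro: pol.intros)
    define p where "p = (\<lambda>s. m (fst s) \<one> (snd s) (fst s))"
    define q where "q = (\<lambda>s. m \<one> \<one> (snd s) (fst s))"
    have p: "p \<in> pol2 ar A" unfolding p_def by (rule m_pol2[OF gens(1,3,2,1)])
    have q: "q \<in> pol2 ar A" unfolding q_def by (rule m_pol2[OF gens(3,3,2,1)])
    \<comment> \<open>Outside \<open>1/\<phi>\<^sup>+\<close> a \<open>\<phi>\<^sup>+\<close>-class is a single \<open>\<phi>\<close>-class, so \<open>p(a, _)\<close> collapses.\<close>
    have "(p (a, \<one>), p (a, b)) \<in> cover \<phi>"
      by (rule pol2_compat[OF con(2) Con_refl[OF con(2) abA(1)] b(1) p])
    moreover have "p (a, \<one>) = a" using m abA(1) unit_carrier by (simp add: p_def)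
    ultimately have "(p (a, \<one>), p (a, b)) \<in> \<phi>"
      using cover_trivial_off_unit_class[OF \<phi> _ a(2)] by simp
    then have "(\<lambda>z. p (a, z)) \<in> ?E"
      using col_iff[OF cov pol2_section[OF p abA(1)] b] by simp
    then have "(\<lambda>z. p (\<one>, z)) \<in> ?E" using a(1) p by (simp add: cen_def)
    \<comment> \<open>Both are \<open>m(1,1,z,1)\<close>; from here only the last argument of \<open>m\<close> varies.\<close>
    moreover have "(\<lambda>z. p (\<one>, z)) = (\<lambda>z. q (\<one>, z))" by (simp add: p_def q_def)
    ultimately have "(\<lambda>z. q (b, z)) \<in> ?E" using b(1) below q by (auto simp: cen_def)
    then have "(q (b, \<one>), q (b, b)) \<in> \<phi>"
      using col_iff[OF cov pol2_section[OF q abA(2)] b] by simp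
    moreover have "q (b, \<one>) = eval A (\<lambda>i. if i = 3 then b else \<one>) t"
      unfolding q_def m_def by (auto intro!: arg_cong[where f = "\<lambda>v. eval A v t"])
    moreover have "q (b, b) = eval A (\<lambda>i. if i = 2 \<or> i = 3 then b else \<one>) t"
      unfolding q_def m_def by (auto intro!: arg_cong[where f = "\<lambda>v. eval A v t"])
    ultimately show "(eval A (\<lambda>i. if i = 3 then b else \<one>) t,
        eval A (\<lambda>i. if i = 2 \<or> i = 3 then b else \<one>) t) \<in> \<phi>" by simp
  qed
  then show False using b(2) by simp
qed

lemma cen_cases:
  assumes "\<phi> \<in> Cm ar A"
  shows "cen (col \<phi> (cover \<phi>)) = \<phi> \<or> cen (col \<phi> (cover \<phi>)) = cover \<phi>"
  using covered_by_cases[OF covers_cover cen_Con covers_subset_cen[OF covers_cover]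
      cen_subset_cover] assms by blast


section \<open>Invariants of projectivity\<close>

lemma transposes_up_covers:
  assumes tr: "transposes_up ar A (\<alpha>, \<beta>) (\<gamma>, \<delta>)"
  shows "\<alpha> \<prec> \<beta> \<longleftrightarrow> \<gamma> \<prec> \<delta>"
proof
  have con: "\<alpha> \<in> Con ar A" "\<beta> \<in> Con ar A" "\<gamma> \<in> Con ar A" "\<delta> \<in> Con ar A"
    and sub: "\<alpha> \<subseteq> \<beta>" "\<gamma> \<subseteq> \<delta>" and meet: "\<beta> \<inter> \<gamma> = \<alpha>" and join: "con_join ar A \<beta> \<gamma> = \<delta>"
    using tr by (auto simp: transposes_up_def is_ivl_def)
  have \<beta>\<delta>: "\<beta> \<subseteq> \<delta>" using con_join_upper(1)[OF con(2,3)] join by simp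
  {
    assume cov: "\<alpha> \<prec> \<beta>"
    have "\<not> (\<gamma> \<subset> \<epsilon> \<and> \<epsilon> \<subset> \<delta>)" if \<epsilon>: "\<epsilon> \<in> Con ar A" for \<epsilon>
    proof
      assume b: "\<gamma> \<subset> \<epsilon> \<and> \<epsilon> \<subset> \<delta>"
      have "\<beta> \<inter> \<epsilon> = \<alpha> \<or> \<beta> \<inter> \<epsilon> = \<beta>"
        by (rule covered_by_cases[OF cov Con_Int[OF con(2) \<epsilon>]]) (use b meet in auto)
      then show False
      proof
        assume "\<beta> \<inter> \<epsilon> = \<alpha>"
        then have "con_join ar A \<gamma> \<beta> \<inter> \<epsilon> = con_join ar A \<gamma> \<alpha>"
          using con_modular_law[OF modular con(3,2) \<epsilon>] b by auto
        also have "\<dots> \<subseteq> \<gamma>" by (rule con_join_least[OF con(3)]) (use meet in auto)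
        finally show False using join b by (auto simp: con_join_commute)
      next
        assume "\<beta> \<inter> \<epsilon> = \<beta>"
        then have "\<delta> \<subseteq> \<epsilon>" using con_join_least[OF \<epsilon>, of \<beta> \<gamma>] b join by auto
        then show False using b by auto
      qed
    qed
    moreover have "\<gamma> \<noteq> \<delta>" using cov \<beta>\<delta> meet by (auto simp: covered_by_def)
    ultimately show "\<gamma> \<prec> \<delta>" using con sub by (auto simp: covered_by_def)
  }
  {
    assume cov: "\<gamma> \<prec> \<delta>"
    have "\<not> (\<alpha> \<subset> \<epsilon> \<and> \<epsilon> \<subset> \<beta>)" if \<epsilon>: "\<epsilon> \<in> Con ar A" for \<epsilon>
    proof
      assume b: "\<alpha> \<subset> \<epsilon> \<and> \<epsilon> \<subset> \<beta>"
      have up: "\<epsilon> \<subseteq> con_join ar A \<epsilon> \<gamma>" "\<gamma> \<subseteq> con_join ar A \<epsilon> \<gamma>"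
        using con_join_upper[OF \<epsilon> con(3)] by auto
      have "con_join ar A \<epsilon> \<gamma> \<subseteq> \<delta>"
        by (rule con_join_least[OF con(4)]) (use b \<beta>\<delta> sub in auto)
      then have "con_join ar A \<epsilon> \<gamma> = \<gamma> \<or> con_join ar A \<epsilon> \<gamma> = \<delta>"
        by (rule covered_by_cases[OF cov con_join_Con[OF algebra_A] up(2)])
      then show False
      proof
        assume "con_join ar A \<epsilon> \<gamma> = \<gamma>"
        then show False using up b meet by auto
      next
        assume "con_join ar A \<epsilon> \<gamma> = \<delta>"
        then have "con_join ar A \<epsilon> (\<gamma> \<inter> \<beta>) = \<delta> \<inter> \<beta>"
          using con_modular_law[OF modular \<epsilon> con(3,2)] b by auto
        moreover have "con_join ar A \<epsilon> (\<gamma> \<inter> \<beta>) \<subseteq> \<epsilon>"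
          by (rule con_join_least[OF \<epsilon>]) (use meet b in auto)
        ultimately show False using b \<beta>\<delta> by auto
      qed
    qed
    moreover have "\<alpha> \<noteq> \<beta>"
    proof
      assume "\<alpha> = \<beta>"
      then have "\<delta> \<subseteq> \<gamma>" using con_join_least[OF con(3), of \<beta> \<gamma>] join meet by auto
      then show False using cov by (auto simp: covered_by_def)
    qed
    ultimately show "\<alpha> \<prec> \<beta>" using con sub by (auto simp: covered_by_def)
  }
qed

lemma transposes_up_col:
  assumes tr: "transposes_up ar A (\<alpha>, \<beta>) (\<gamma>, \<delta>)" and cov: "\<alpha> \<prec> \<beta>"
  shows "col \<alpha> \<beta> = col \<gamma> \<delta>"
proof -
  have cov': "\<gamma> \<prec> \<delta>" using transposes_up_covers[OF tr] cov by simp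
  have meet: "\<beta> \<inter> \<gamma> = \<alpha>" and join: "con_join ar A \<beta> \<gamma> = \<delta>" using tr by (auto simp: transposes_up_def)
  have \<beta>\<delta>: "\<beta> \<subseteq> \<delta>" using con_join_upper(1)[of \<beta> ar A \<gamma>] covers_Con[OF cov] covers_Con[OF cov'] join by simp
  obtain b where b: "(\<one>, b) \<in> \<beta>" "(\<one>, b) \<notin> \<alpha>" by (rule covers_witness[OF cov])
  then have b': "(\<one>, b) \<in> \<delta>" "(\<one>, b) \<notin> \<gamma>" using meet \<beta>\<delta> by auto
  have "u \<in> col \<alpha> \<beta> \<longleftrightarrow> u \<in> col \<gamma> \<delta>" if u: "u \<in> pol1 ar A" for u
  proof -
    have "(u \<one>, u b) \<in> \<beta>" by (rule pol1_compat[OF covers_Con(2)[OF cov] b(1) u])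
    then show ?thesis using col_iff[OF cov u b] col_iff[OF cov' u b'] meet by auto
  qed
  then show ?thesis using col_pol1 by blast
qed

text \<open>The condition \<open>\<beta> \<subseteq> cen (col \<alpha> \<beta>)\<close> says that the cover is abelian. Carrying it along a
  projectivity excludes that the common centralizer is \<open>\<phi>\<close> at one end and \<open>\<psi>\<^sup>+\<close> at the other.
  Since \<open>\<gamma>\<close> is contained in the centralizer anyway, so is \<open>\<delta> = \<beta> \<squnion> \<gamma>\<close> as soon as \<open>\<beta>\<close> is.\<close>

lemma transposes_up_abelian:
  assumes tr: "transposes_up ar A (\<alpha>, \<beta>) (\<gamma>, \<delta>)" and cov: "\<alpha> \<prec> \<beta>"
  shows "\<beta> \<subseteq> cen (col \<alpha> \<beta>) \<longleftrightarrow> \<delta> \<subseteq> cen (col \<gamma> \<delta>)"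
proof -
  have cov': "\<gamma> \<prec> \<delta>" using transposes_up_covers[OF tr] cov by simp
  have join: "con_join ar A \<beta> \<gamma> = \<delta>" using tr by (simp add: transposes_up_def)
  have "\<beta> \<subseteq> \<delta>" using con_join_upper(1)[of \<beta> ar A \<gamma>] covers_Con[OF cov] covers_Con[OF cov'] join by simp
  moreover have "\<delta> \<subseteq> cen (col \<gamma> \<delta>)" if "\<beta> \<subseteq> cen (col \<gamma> \<delta>)"
    using con_join_least[OF cen_Con that covers_subset_cen[OF cov']] join by simp
  ultimately show ?thesis using transposes_up_col[OF tr cov] by auto
qed

lemma projective_invariants:
  assumes "projective ar A I J" "fst I \<prec> snd I"
  shows "fst J \<prec> snd J \<and> col (fst J) (snd J) = col (fst I) (snd I) \<and>
    (snd J \<subseteq> cen (col (fst J) (snd J)) \<longleftrightarrow> snd I \<subseteq> cen (col (fst I) (snd I)))"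
  using assms(1) unfolding projective_def
proof (induction rule: rtranclp_induct)
  case (step J K)
  have J: "fst J \<prec> snd J" using step.IH by simp
  from step.hyps(2) show ?case
  proof
    assume "transposes_up ar A J K"
    then have "transposes_up ar A (fst J, snd J) (fst K, snd K)" by simp
    note * = transposes_up_covers[OF this] transposes_up_col[OF this J] transposes_up_abelian[OF this J]
    show ?thesis using * step.IH J by metis
  next
    assume "transposes_up ar A K J"
    then have tr: "transposes_up ar A (fst K, snd K) (fst J, snd J)" by simp
    then have K: "fst K \<prec> snd K" using transposes_up_covers J by blast
    show ?thesis
      using K transposes_up_col[OF tr K] transposes_up_abelian[OF tr K] step.IH by metis
  qed
qed (simp add: assms(2))

text \<open>The common centralizer is one of \<open>\<phi>\<close>, \<open>\<phi>\<^sup>+\<close> and one of \<open>\<psi>\<close>, \<open>\<psi>\<^sup>+\<close>; it is the larger one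
  in both cases or the smaller one in both cases, as the covers are both abelian or both
  non-abelian.\<close>

lemma Cm_sim_invariants:
  assumes sim: "Cm_sim ar A \<phi> \<psi>"
  shows "cover \<psi> = cover \<phi>" "col \<psi> (cover \<psi>) = col \<phi> (cover \<phi>)"
    "\<psi> = \<phi> \<or> cen (col \<phi> (cover \<phi>)) = cover \<phi>"
proof -
  have \<phi>: "\<phi> \<in> Cm ar A" and \<psi>: "\<psi> \<in> Cm ar A"
    and pr: "projective ar A (\<phi>, cover \<phi>) (\<psi>, cover \<psi>)"
    using sim by (auto simp: Cm_sim_def)
  note inv = projective_invariants[OF pr, simplified, OF covers_cover[OF \<phi>]]
  show "col \<psi> (cover \<psi>) = col \<phi> (cover \<phi>)" using inv by simp
  then have "cen (col \<phi> (cover \<phi>)) = \<psi> \<or> cen (col \<phi> (cover \<phi>)) = cover \<psi>"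
    using cen_cases[OF \<psi>] by simp
  moreover note cen_cases[OF \<phi>] inv cover_greater[OF \<phi>] cover_greater[OF \<psi>]
  ultimately have "\<psi> = \<phi> \<or> cen (col \<phi> (cover \<phi>)) = cover \<phi> \<and> cover \<psi> = cover \<phi>"
    by (metis order_refl psubset_eq subset_antisym)
  then show "cover \<psi> = cover \<phi>" "\<psi> = \<phi> \<or> cen (col \<phi> (cover \<phi>)) = cover \<phi>" by auto
qed

text \<open>The third coatom of the diamond generated by \<open>\<phi>\<close> and \<open>\<psi>\<close> is built by hand: on \<open>1/\<phi>\<^sup>+\<close> it
  is the sum of two characters with values in a two-element group, whose kernels are \<open>\<phi>\<close> and \<open>\<psi>\<close>;
  elsewhere \<open>\<phi>\<close>, \<open>\<psi>\<close> and their cover agree. It is compatible because a polynomial separates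
  the two classes of \<open>\<phi>\<close> iff it separates those of \<open>\<psi>\<close>.\<close>

lemma Cm_sim_if_same_col:
  assumes \<phi>: "\<phi> \<in> Cm ar A" and \<psi>: "\<psi> \<in> Cm ar A" and cover: "cover \<psi> = cover \<phi>"
    and same: "col \<psi> (cover \<psi>) = col \<phi> (cover \<phi>)"
  shows "Cm_sim ar A \<phi> \<psi>"
proof (cases "\<phi> = \<psi>")
  case True
  then show ?thesis using \<phi> by (simp add: Cm_sim_def projective_def)
next
  case False
  define \<delta> where "\<delta> = cover \<phi>"
  have cov: "\<phi> \<prec> \<delta>" "\<psi> \<prec> \<delta>" using covers_cover[OF \<phi>] covers_cover[OF \<psi>] cover by (auto simp: \<delta>_def)
  have con: "\<phi> \<in> Con ar A" "\<psi> \<in> Con ar A" "\<delta> \<in> Con ar A" using cov by (auto simp: covers_Con)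
  have sub: "\<phi> \<subset> \<delta>" "\<psi> \<subset> \<delta>" using cov by (auto simp: covered_by_def)
  define \<gamma> where "\<gamma> = {(x, y) \<in> \<delta>. (x, y) \<in> \<phi> \<longleftrightarrow> (x, y) \<in> \<psi>}"
  have outside: "(x, y) \<in> \<phi> \<inter> \<psi>" if "(x, y) \<in> \<delta>" "(\<one>, x) \<notin> \<delta>" for x y
    using cover_trivial_off_unit_class[OF \<phi>] cover_trivial_off_unit_class[OF \<psi>] that cover
    by (simp add: \<delta>_def)
  have \<gamma>: "\<gamma> \<in> Con ar A"
  proof (rule Con_if_pol1_closed[OF algebra_A])
    show "equiv (carrier A) \<gamma>"
    proof (rule equivI)
      show "\<gamma> \<subseteq> carrier A \<times> carrier A" using Con_subset[OF con(3)] by (auto simp: \<gamma>_def)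
      show "refl_on (carrier A) \<gamma>"
        using Con_refl[OF con(1)] Con_refl[OF con(2)] Con_refl[OF con(3)] by (auto simp: \<gamma>_def refl_on_def)
      show "sym \<gamma>" using Con_sym[OF con(1)] Con_sym[OF con(2)] Con_sym[OF con(3)]
        by (auto simp: \<gamma>_def sym_def)
      show "trans \<gamma>"
      proof (rule transI)
        fix x y z assume a: "(x, y) \<in> \<gamma>" "(y, z) \<in> \<gamma>"
        then have d: "(x, y) \<in> \<delta>" "(y, z) \<in> \<delta>" by (auto simp: \<gamma>_def)
        then have xz: "(x, z) \<in> \<delta>" by (rule Con_trans[OF con(3)])
        show "(x, z) \<in> \<gamma>"
        proof (cases "(\<one>, x) \<in> \<delta>")
          case True
          then have yz: "(\<one>, y) \<in> \<delta>" "(\<one>, z) \<in> \<delta>" using d Con_trans[OF con(3)] by blast+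
          note i = same_class_iff[OF cov(1)] same_class_iff[OF cov(2)]
          show ?thesis
            using a xz i[OF True yz(1)] i[OF yz] i[OF True yz(2)] unfolding \<gamma>_def by blast
        next
          case False
          then show ?thesis using outside[OF xz] xz by (simp add: \<gamma>_def)
        qed
      qed
    qed
  next
    fix u x y assume u: "u \<in> pol1 ar A" and xy: "(x, y) \<in> \<gamma>"
    then have d: "(x, y) \<in> \<delta>" by (simp add: \<gamma>_def)
    have ud: "(u x, u y) \<in> \<delta>" by (rule pol1_compat[OF con(3) d u])
    show "(u x, u y) \<in> \<gamma>"
    proof (cases "(x, y) \<in> \<phi>")
      case True
      then have "(x, y) \<in> \<psi>" using xy by (simp add: \<gamma>_def)
      then show ?thesis
        using ud pol1_compat[OF con(1) True u] pol1_compat[OF con(2) _ u] by (simp add: \<gamma>_def)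
    next
      case False
      then have F: "(x, y) \<notin> \<psi>" using xy by (simp add: \<gamma>_def)
      have x: "(\<one>, x) \<in> \<delta>" using outside[OF d] F by blast
      have y: "(\<one>, y) \<in> \<delta>" by (rule Con_trans[OF con(3) x d])
      show ?thesis
        using ud col_iff_pair[OF cov(1) u x y False] col_iff_pair[OF cov(2) u x y F] same cover
        by (simp add: \<gamma>_def \<delta>_def)
    qed
  qed
  \<comment> \<open>A pair of \<open>\<gamma>\<close> in neither \<open>\<phi>\<close> nor \<open>\<psi>\<close> makes the joins of \<open>\<gamma>\<close> with them equal to \<open>\<delta>\<close>.\<close>
  have "\<not> \<phi> \<subseteq> \<psi>" "\<not> \<psi> \<subseteq> \<phi>"
    using False cover_least[OF \<phi> con(2)] cover_least[OF \<psi> con(1)] sub cover by (auto simp: \<delta>_def)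
  then obtain b c where b: "(\<one>, b) \<in> \<phi>" "(\<one>, b) \<notin> \<psi>" and c: "(\<one>, c) \<in> \<psi>" "(\<one>, c) \<notin> \<phi>"
    using regular_subset[OF con(1,2)] regular_subset[OF con(2,1)] by blast
  have "(\<one>, b) \<in> \<delta>" "(\<one>, c) \<in> \<delta>" using b c sub by auto
  then have "(b, c) \<in> \<delta>" using Con_sym[OF con(3)] Con_trans[OF con(3)] by blast
  moreover have nbc: "(b, c) \<notin> \<phi>" "(b, c) \<notin> \<psi>"
    using b c Con_sym[OF con(1)] Con_trans[OF con(1)] Con_sym[OF con(2)] Con_trans[OF con(2)] by blast+
  ultimately have bc: "(b, c) \<in> \<gamma>" by (simp add: \<gamma>_def)
  have tr: "transposes_up ar A (\<phi> \<inter> \<psi>, \<gamma>) (\<chi>, \<delta>)" if \<chi>: "\<chi> = \<phi> \<or> \<chi> = \<psi>" for \<chi>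
  proof -
    have \<chi>c: "\<chi> \<in> Con ar A" "\<chi> \<prec> \<delta>" "(b, c) \<notin> \<chi>" using \<chi> con cov nbc by auto
    have \<gamma>\<delta>: "\<gamma> \<subseteq> \<delta>" by (auto simp: \<gamma>_def)
    have "con_join ar A \<gamma> \<chi> = \<chi> \<or> con_join ar A \<gamma> \<chi> = \<delta>"
      using covered_by_cases[OF \<chi>c(2) con_join_Con[OF algebra_A] con_join_upper(2)[OF \<gamma> \<chi>c(1)]]
        con_join_least[OF con(3) \<gamma>\<delta>] \<chi> sub by auto
    then have "con_join ar A \<gamma> \<chi> = \<delta>" using con_join_upper(1)[OF \<gamma> \<chi>c(1)] bc \<chi>c(3) by auto
    moreover have "\<gamma> \<inter> \<chi> = \<phi> \<inter> \<psi>" using \<chi> sub by (auto simp: \<gamma>_def)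
    moreover have "\<phi> \<inter> \<psi> \<subseteq> \<gamma>" using sub by (auto simp: \<gamma>_def)
    ultimately show ?thesis
      using \<chi> con \<gamma> Con_Int[OF con(1,2)] sub by (auto simp: transposes_up_def is_ivl_def)
  qed
  have "projective ar A (\<phi>, \<delta>) (\<phi> \<inter> \<psi>, \<gamma>)" "projective ar A (\<phi> \<inter> \<psi>, \<gamma>) (\<psi>, \<delta>)"
    using tr unfolding projective_def by (auto intro!: r_into_rtranclp)
  then have "projective ar A (\<phi>, \<delta>) (\<psi>, \<delta>)" unfolding projective_def by (rule rtranclp_trans)
  then show ?thesis using \<phi> \<psi> cover by (simp add: Cm_sim_def \<delta>_def)
qed


section \<open>The interval below a class of meet irreducible congruences\<close>

context
  fixes \<mu> :: "('a \<times> 'a) set"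
  assumes \<mu>: "\<mu> \<in> Cm ar A"
begin

abbreviation zero_U :: "('a \<times> 'a) set" where
  "zero_U \<equiv> con_Meet A (sim_class ar A \<mu>)"

lemma sim_class_Cm: "\<phi> \<in> sim_class ar A \<mu> \<Longrightarrow> \<phi> \<in> Cm ar A"
  by (simp add: sim_class_def Cm_sim_def)

lemma sim_class_cover: "\<phi> \<in> sim_class ar A \<mu> \<Longrightarrow> cover \<phi> = cover \<mu>"
  unfolding sim_class_def by (simp add: Cm_sim_invariants)

lemma sim_class_col: "\<phi> \<in> sim_class ar A \<mu> \<Longrightarrow> col \<phi> (cover \<mu>) = col \<mu> (cover \<mu>)"
  using Cm_sim_invariants(1,2)[of \<mu> \<phi>] by (simp add: sim_class_def)

lemma \<mu>_sim_class: "\<mu> \<in> sim_class ar A \<mu>"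
  using Cm_sim_if_same_col[OF \<mu> \<mu>] by (simp add: sim_class_def)

lemma zero_U_lower: "\<phi> \<in> sim_class ar A \<mu> \<Longrightarrow> zero_U \<subseteq> \<phi>"
  by (auto simp: con_Meet_def)

lemma zero_UI:
  assumes "\<And>\<phi>. \<phi> \<in> sim_class ar A \<mu> \<Longrightarrow> (x, y) \<in> \<phi>"
  shows "(x, y) \<in> zero_U"
  using assms assms[OF \<mu>_sim_class] Con_subset[OF Cm_Con[OF \<mu>]] by (auto simp: con_Meet_def)

lemma singleton_or_abelian: "zero_U = \<mu> \<or> cen (col \<mu> (cover \<mu>)) = cover \<mu>"
proof (cases "\<forall>\<phi>\<in>sim_class ar A \<mu>. \<phi> = \<mu>")
  case True
  have "\<mu> \<subseteq> zero_U" by (intro subrelI zero_UI) (use True in blast)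
  then show ?thesis using zero_U_lower[OF \<mu>_sim_class] by auto
next
  case False
  then show ?thesis using Cm_sim_invariants(3) by (auto simp: sim_class_def)
qed

text \<open>Modulo each member of the class, \<open>u\<close> permutes the two classes in \<open>1/\<mu>\<^sup>+\<close>: their images are
  distinct, and they stay in \<open>1/\<mu>\<^sup>+\<close> because elsewhere the cover identifies nothing new. The square
  of a permutation of two classes is the identity.\<close>

lemma noncollapsing_involution:
  assumes u: "u \<in> pol1 ar A" "u \<notin> col \<mu> (cover \<mu>)" and x: "(\<one>, x) \<in> cover \<mu>"
  shows "(u (u x), x) \<in> zero_U"
proof (rule zero_UI)
  fix \<phi> assume \<phi>U: "\<phi> \<in> sim_class ar A \<mu>"
  note \<phi> = sim_class_Cm[OF \<phi>U] and cov\<mu> = sim_class_cover[OF \<phi>U]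
  have cov: "\<phi> \<prec> cover \<mu>" using covers_cover[OF \<phi>] cov\<mu> by simp
  note con = covers_Con[OF cov]
  note tr = Con_trans[OF con(1)] and sy = Con_sym[OF con(1)] and cp = pol1_compat[OF con(1) _ u(1)]
  obtain b where b: "(\<one>, b) \<in> cover \<mu>" "(\<one>, b) \<notin> \<phi>" by (rule covers_witness[OF cov])
  have ub: "(u \<one>, u b) \<notin> \<phi>" using u sim_class_col[OF \<phi>U] col_iff[OF cov u(1) b] by simp
  have ub': "(u \<one>, u b) \<in> cover \<mu>" by (rule pol1_compat[OF con(2) b(1) u(1)])
  have u1: "(\<one>, u \<one>) \<in> cover \<mu>"
    using cover_trivial_off_unit_class[OF \<phi>, unfolded cov\<mu>, OF ub'] ub by blast
  then have u1b: "(\<one>, u b) \<in> cover \<mu>" using ub' Con_trans[OF con(2)] by blast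
  have cls: "(\<one>, z) \<in> \<phi> \<or> (b, z) \<in> \<phi>" if "(\<one>, z) \<in> cover \<mu>" for z
    using same_class_iff[OF cov b(1) that] b(2) by blast
  have "(u (u \<one>), \<one>) \<in> \<phi> \<and> (u (u b), b) \<in> \<phi>"
  proof (cases "(\<one>, u \<one>) \<in> \<phi>")
    case True
    then have "(b, u b) \<in> \<phi>" using cls[OF u1b] ub tr sy by blast
    then show ?thesis using True cp tr sy by blast
  next
    case False
    then have 1: "(b, u \<one>) \<in> \<phi>" using cls[OF u1] by blast
    then have 2: "(\<one>, u b) \<in> \<phi>" using cls[OF u1b] ub tr sy by blast
    show ?thesis using 1 2 cp[OF 1] cp[OF 2] tr sy by blast
  qed
  then show "(u (u x), x) \<in> \<phi>" using cls[OF x] cp tr sy by meson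
qed

text \<open>A collapsing polynomial collapses modulo the meet of the class, a non-collapsing one is its
  own inverse modulo that meet. So both kinds are recognized by any congruence above it that does
  not contain the test pair.\<close>

lemma col_iff_above_zero_U:
  assumes \<theta>: "\<theta> \<in> Con ar A" "zero_U \<subseteq> \<theta>" and c: "(\<one>, c) \<in> cover \<mu>" "(\<one>, c) \<notin> \<theta>"
    and u: "u \<in> pol1 ar A"
  shows "u \<in> col \<mu> (cover \<mu>) \<longleftrightarrow> (u \<one>, u c) \<in> \<theta>"
proof
  assume "u \<in> col \<mu> (cover \<mu>)"
  then have "(u \<one>, u c) \<in> \<phi>" if "\<phi> \<in> sim_class ar A \<mu>" for \<phi>
    using sim_class_col[OF that] c(1) by (auto simp: col_def)
  then show "(u \<one>, u c) \<in> \<theta>" using zero_UI \<theta>(2) by blast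
next
  assume "(u \<one>, u c) \<in> \<theta>"
  then have uu: "(u (u \<one>), u (u c)) \<in> \<theta>" by (rule pol1_compat[OF \<theta>(1) _ u])
  show "u \<in> col \<mu> (cover \<mu>)"
  proof (rule ccontr)
    assume n: "u \<notin> col \<mu> (cover \<mu>)"
    have "(u (u \<one>), \<one>) \<in> \<theta>" "(u (u c), c) \<in> \<theta>"
      using noncollapsing_involution[OF u n] c(1) \<theta>(2)
        Con_refl[OF cover_Con[OF \<mu>] unit_carrier] by auto
    then show False using uu c(2) Con_trans[OF \<theta>(1)] Con_sym[OF \<theta>(1)] by blast
  qed
qed

text \<open>In the abelian case \<open>\<mu>\<^sup>+\<close> is the centralizer, and \<open>\<alpha>\<close> tests collapsing unless it contains
  \<open>\<mu>\<^sup>+\<close>.\<close>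

lemma comparable_above_zero_U:
  assumes \<alpha>: "\<alpha> \<in> Con ar A" "zero_U \<subseteq> \<alpha>"
  shows "\<alpha> \<subseteq> cover \<mu> \<or> cover \<mu> \<subseteq> \<alpha>"
proof (cases "zero_U = \<mu>")
  case True
  then show ?thesis using \<alpha> cover_least[OF \<mu> \<alpha>(1)] cover_greater[OF \<mu>] by auto
next
  case False
  then have abelian: "cen (col \<mu> (cover \<mu>)) = cover \<mu>" using singleton_or_abelian by blast
  show ?thesis
  proof (rule disjCI)
    assume "\<not> cover \<mu> \<subseteq> \<alpha>"
    then obtain c where c: "(\<one>, c) \<in> cover \<mu>" "(\<one>, c) \<notin> \<alpha>"
      by (rule regular_witness[OF cover_Con[OF \<mu>] \<alpha>(1)])
    have cA: "c \<in> carrier A" using Con_subset[OF cover_Con[OF \<mu>]] c(1) by auto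
    show "\<alpha> \<subseteq> cover \<mu>"
      using subset_cen[OF \<alpha>(1) cA col_iff_above_zero_U[OF \<alpha> c]] abelian by simp
  qed
qed

lemma sim_class_eq_Cm_ivl: "sim_class ar A \<mu> = Cm ar A \<inter> con_ivl_right_open ar A zero_U (cover \<mu>)"
proof (intro subset_antisym subsetI IntI)
  fix \<phi> assume \<phi>U: "\<phi> \<in> sim_class ar A \<mu>"
  note \<phi> = sim_class_Cm[OF \<phi>U]
  show "\<phi> \<in> Cm ar A" by (fact \<phi>)
  show "\<phi> \<in> con_ivl_right_open ar A zero_U (cover \<mu>)"
    using zero_U_lower[OF \<phi>U] cover_greater[OF \<phi>] sim_class_cover[OF \<phi>U] Cm_Con[OF \<phi>]
    by (simp add: con_ivl_right_open_def)
next
  fix \<psi> assume "\<psi> \<in> Cm ar A \<inter> con_ivl_right_open ar A zero_U (cover \<mu>)"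
  then have \<psi>: "\<psi> \<in> Cm ar A" and zero: "zero_U \<subseteq> \<psi>" and lt: "\<psi> \<subset> cover \<mu>"
    by (auto simp: con_ivl_right_open_def)
  show "\<psi> \<in> sim_class ar A \<mu>"
  proof (cases "zero_U = \<mu>")
    case True
    then have "\<psi> = \<mu>" using covered_by_cases[OF covers_cover[OF \<mu>] Cm_Con[OF \<psi>]] zero lt by auto
    then show ?thesis using \<mu>_sim_class by simp
  next
    case False
    then have abelian: "cen (col \<mu> (cover \<mu>)) = cover \<mu>" using singleton_or_abelian by blast
    have below: "cover \<psi> \<subseteq> cover \<mu>" by (rule cover_least[OF \<psi> cover_Con[OF \<mu>] lt])
    obtain b where b: "(\<one>, b) \<in> cover \<psi>" "(\<one>, b) \<notin> \<psi>" by (rule covers_witness[OF covers_cover[OF \<psi>]])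
    have "u \<in> col \<mu> (cover \<mu>) \<longleftrightarrow> u \<in> col \<psi> (cover \<psi>)" if u: "u \<in> pol1 ar A" for u
      using col_iff[OF covers_cover[OF \<psi>] u b] b below
        col_iff_above_zero_U[OF Cm_Con[OF \<psi>] zero _ b(2) u] by blast
    then have col: "col \<psi> (cover \<psi>) = col \<mu> (cover \<mu>)" using col_pol1 by blast
    then have "cover \<psi> = cover \<mu>" using cen_subset_cover[OF \<psi>] abelian below by simp
    then show ?thesis using Cm_sim_if_same_col[OF \<mu> \<psi>] col by (simp add: sim_class_def)
  qed
qed

lemma sim_class_eq_coatoms:
  "sim_class ar A \<mu> = {\<beta> \<in> Con ar A. zero_U \<subseteq> \<beta> \<and> \<beta> \<prec> cover \<mu>}"
proof (intro subset_antisym subsetI CollectI)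
  fix \<phi> assume \<phi>U: "\<phi> \<in> sim_class ar A \<mu>"
  note \<phi> = sim_class_Cm[OF \<phi>U]
  show "\<phi> \<in> Con ar A \<and> zero_U \<subseteq> \<phi> \<and> \<phi> \<prec> cover \<mu>"
    using zero_U_lower[OF \<phi>U] covers_cover[OF \<phi>] sim_class_cover[OF \<phi>U] Cm_Con[OF \<phi>] by simp
next
  fix \<beta> assume "\<beta> \<in> {\<beta> \<in> Con ar A. zero_U \<subseteq> \<beta> \<and> \<beta> \<prec> cover \<mu>}"
  then have \<beta>: "\<beta> \<in> Con ar A" and zero: "zero_U \<subseteq> \<beta>" and cov: "\<beta> \<prec> cover \<mu>" by auto
  have lt: "\<beta> \<subset> cover \<mu>" using cov by (simp add: covered_by_def)
  have "cover \<mu> \<subseteq> \<delta>" if \<delta>: "\<delta> \<in> Con ar A" "\<beta> \<subset> \<delta>" for \<delta>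
  proof -
    have "\<delta> \<subseteq> cover \<mu> \<or> cover \<mu> \<subseteq> \<delta>"
      by (rule comparable_above_zero_U[OF \<delta>(1)]) (use zero \<delta>(2) in blast)
    moreover have "\<delta> = cover \<mu>" if "\<delta> \<subseteq> cover \<mu>"
      using covered_by_cases[OF cov \<delta>(1) _ that] \<delta>(2) by auto
    ultimately show ?thesis by blast
  qed
  then have "\<beta> \<in> Cm ar A" by (intro CmI[OF \<beta> cover_Con[OF \<mu>] lt]) simp
  then have "\<beta> \<in> Cm ar A \<inter> con_ivl_right_open ar A zero_U (cover \<mu>)"
    using \<beta> zero lt by (simp add: con_ivl_right_open_def)
  then show "\<beta> \<in> sim_class ar A \<mu>" by (rule equalityD2[OF sim_class_eq_Cm_ivl, THEN subsetD])
qed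

end

end


theorem theorem16:
  fixes ar :: "'f \<Rightarrow> nat" and A :: "('f, 'a) alg" and e :: "('f, nat) trm"
    and \<mu> :: "('a \<times> 'a) set"
  assumes "strongly_Fregean ar A e"
    and "\<mu> \<in> Cm ar A"
  shows "let U = sim_class ar A \<mu>; zero_U = con_Meet A U; \<mu>_plus = upper_cover ar A \<mu> in
      U = {\<beta> \<in> Con ar A. zero_U \<subseteq> \<beta> \<and> covered_by ar A \<beta> \<mu>_plus} \<and>
      U = Cm ar A \<inter> con_ivl_right_open ar A zero_U \<mu>_plus \<and>
      (\<forall>\<alpha>\<in>Con ar A. zero_U \<subseteq> \<alpha> \<longrightarrow> \<alpha> \<subseteq> \<mu>_plus \<or> \<mu>_plus \<subseteq> \<alpha>)"
proof -
  interpret strongly_Fregean_algebra ar A e by standard (rule assms(1))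
  show ?thesis
    unfolding Let_def
    by (intro conjI ballI impI sim_class_eq_coatoms[OF assms(2)] sim_class_eq_Cm_ivl[OF assms(2)]
        comparable_above_zero_U[OF assms(2)])
qed

end
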